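(* Let $\mathcal{S}\subset\mathbb{R}^{n_1\times 1\times n_3}$ be the $n_2$-dimensional tensor-column subspace spanned by the columns of $\mathcal{U}\in\mathbb{R}^{n_1\times n_2\times n_3}$ with $\mathcal{U}^{\dagger}\bullet\mathcal{U}=\mathcal{I}$, let $\mathcal{P}$ be the orthogonal projection onto $\mathcal{S}$, let $\bm{S}\subset\mathbb{R}^{n_1n_3}$ be the vector subspace spanned by the columns of $\bm{U}=\mathrm{lmat}(\mathcal{U})$, and $\mu(\bm{S})$ its coherence. Let $\mathcal{T}\in\mathbb{R}^{n_1\times1\times n_3}$ and write $\mathcal{T}=\mathcal{X}+\mathcal{Y}$ with $\mathcal{X}\in\mathcal{S}$, $\mathcal{Y}\in\mathcal{S}^{\bot}$; let $\bm{t}=\mathrm{unfold}(\mathcal{T})$ and write $\bm{t}=\bm{x}+\bm{y}$ with $\bm{x}\in\bm{S}$, $\bm{y}\in\bm{S}^{\bot}$. Let $\theta$ be the principal angle between $\mathrm{unfold}(\mathcal{Y})$ and $\bm{S}^{\bot}$. Let $\Omega\subset\{1,\dots,n_1\}\times\{1,\dots,n_3\}$ be the index set of an elementwise sample, taken uniformly with replacement, with sample size $m=|\Omega|$. Let $\delta>0$ and $m\ge\frac{8}{3}n_2n_3\mu(\bm{S})\log\left(\frac{2n_2n_3}{\delta}\right)$. Then with probability at least $1-4\delta$, $$\frac{m(1-\alpha)-n_2n_3\mu(\bm{S})\frac{\beta}{(1-\gamma)}}{n_1n_3}\cos^2(\theta)\left\|\mathcal{T}-\mathcal{P}\bullet\mathcal{T}\right\|_F^2\le\left\|\bm{t}_{\Omega}-\bm{P}_{\Omega}\bm{t}_{\Omega}\right\|_2^2\le(1+\alpha)\frac{m}{n_1n_3}\cos^2(\theta)\left\|\mathcal{T}-\mathcal{P}\bullet\mathcal{T}\right\|_F^2$$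 holds, where $$\alpha=\sqrt{\frac{2(n_1n_3\|\bm{y}\|_\infty^2-\|\bm{y}\|_2^2)}{m\|\bm{y}\|_2^2}\log\left(\tfrac1\delta\right)}+\frac{2(n_1n_3\|\bm{y}\|_\infty^2-\|\bm{y}\|_2^2)}{3m\|\bm{y}\|_2^2}\log\left(\tfrac1\delta\right),$$ $$\beta=\left(1+2\sqrt{\log\left(\tfrac1\delta\right)}\right)^2,\qquad\gamma=\sqrt{\frac{8n_2n_3\mu(\bm{S})}{3m}\log\left(\frac{2n_2n_3}{\delta}\right)}.$$
   Context: Transform and products. $\mathcal{L}:\mathbb{R}^{1\times1\times n_3}\to\mathbb{R}^{1\times1\times n_3}$ is an invertible linear transform on tubes given by an $n_3\times n_3$ matrix $\bm{M}$: $\mathcal{L}(\bm{a})(1,1,i)=(\bm{M}\,\mathrm{vec}(\bm{a}))_i$. It is taken that $\|\mathcal{L}(\bm{a})\|_F=c\|\bm{a}\|_F$ for tubes $\bm{a}$, where $c$ is a constant with $0<c\le\|\bm{M}\|$ (spectral norm). The tube product is $\bm{a}\bullet\bm{b}=\mathcal{L}^{-1}(\mathcal{L}(\bm{a})\circ\mathcal{L}(\bm{b}))$, where $\circ$ is the entrywise product. For $\mathcal{A}\in\mathbb{R}^{n_1\times n_2\times n_3}$ and $\mathcal{B}\in\mathbb{R}^{n_2\times n_4\times n_3}$, $\mathcal{A}\bullet\mathcal{B}\in\mathbb{R}^{n_1\times n_4\times n_3}$ has tubes $(\mathcal{A}\bullet\mathcal{B})(i,j,:)=\sum_{s=1}^{n_2}\mathcal{A}(i,s,:)\bullet\mathcal{B}(s,j,:)$.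 $\mathcal{L}(\mathcal{A})$ is obtained by applying $\mathcal{L}$ to every tube $\mathcal{A}(i,j,:)$, and $\mathcal{A}^{(k)}=\mathcal{A}(:,:,k)$. The transpose $\mathcal{A}^{\dagger}$ is defined by $\mathcal{L}(\mathcal{A}^{\dagger})^{(k)}=(\mathcal{L}(\mathcal{A})^{(k)})^H$ for all $k$. With $\bm{e}=\mathcal{L}^{-1}(\bm{1})$ ($\bm{1}$ the all-ones tube), the identity tensor $\mathcal{I}$ has $\bm{e}$ as each diagonal tube and zero tubes elsewhere; inverses of tensors are with respect to $\bullet$ and $\mathcal{I}$. Tensor subspaces. The tensor-column subspace spanned by the columns $\mathcal{U}_j=\mathcal{U}(:,j,:)$ is $\mathcal{S}=\{\sum_{j}\mathcal{U}_j\bullet\bm{c}_j:\bm{c}_j\text{ arbitrary tubes of length }n_3\}$; the orthogonal projection onto it is $\mathcal{P}=\mathcal{U}\bullet(\mathcal{U}^{\dagger}\bullet\mathcal{U})^{-1}\bullet\mathcal{U}^{\dagger}$, and $\mathcal{S}^{\bot}=\{\mathcal{Y}\in\mathbb{R}^{n_1\times 1\times n_3}:\mathcal{U}^{\dagger}\bullet\mathcal{Y}=0\}$ is the orthogonal subspace. Vectorization. $\mathrm{unfold}(\mathcal{A})$ stacks the frontal slices $\mathcal{A}^{(1)},\dots,\mathcal{A}^{(n_3)}$ vertically; for $\mathcal{T}\in\mathbb{R}^{n_1\times1\times n_3}$ the entry $\mathcal{T}(i,1,j)$ is entry $(j-1)n_1+i$ of $\mathrm{unfold}(\mathcal{T})\in\mathbb{R}^{n_1n_3}$.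 $\mathrm{lmat}(\mathcal{U})$ is the $n_1n_3\times n_2n_3$ matrix with $\mathrm{unfold}(\mathcal{U}\bullet\mathcal{C})=\mathrm{lmat}(\mathcal{U})\,\mathrm{unfold}(\mathcal{C})$ for all $\mathcal{C}\in\mathbb{R}^{n_2\times1\times n_3}$. $\bm{S}^{\bot}$ is the orthogonal complement of $\bm{S}$ in $\mathbb{R}^{n_1n_3}$; $\bm{P}_{\bm{S}}$, $\bm{P}_{\bm{S}^{\bot}}$ are the orthogonal projections. The coherence is $\mu(\bm{S})=\frac{n_1}{n_2}\max_j\|\bm{P}_{\bm{S}}\bm{e}_j\|_2^2$ with $\bm{e}_j$ the standard basis vectors of $\mathbb{R}^{n_1n_3}$. The angle $\theta$ is given by $\cos(\theta)=\|\bm{P}_{\bm{S}^{\bot}}\mathrm{unfold}(\mathcal{Y})\|_2/\|\mathrm{unfold}(\mathcal{Y})\|_2$. $\|\bm{y}\|_\infty$ is the maximum absolute entry; $\|\cdot\|_F$ is the square root of the sum of squares of entries. Elementwise-sampling. $\mathcal{T}_\Omega\in\mathbb{R}^{n_1\times1\times n_3}$ has $\mathcal{T}_\Omega(i,1,j)=\mathcal{T}(i,1,j)$ if $(i,j)\in\Omega$ and $0$ otherwise, and $\bm{t}_\Omega=\mathrm{unfold}(\mathcal{T}_\Omega)$. $\bm{U}_\Omega$ is the $n_1n_3\times n_2n_3$ matrix whose row $(j-1)n_1+i$ equals row $(j-1)n_1+i$ of $\bm{U}$ if $(i,j)\in\Omega$ and $\bm{0}$ otherwise. $\bm{P}_\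Omega=\bm{U}_\Omega(\bm{U}_\Omega^H\bm{U}_\Omega)^{-1}\bm{U}_\Omega^H$.
   Formalization: Ω is taken as a multiset of m independent uniform draws: an entry of T_Ω or row of U_Ω drawn r times is weighted by √r (so sums run over the draws), since with plain zero-or-keep restriction the lower bound fails for large m; the lower bound is claimed only when γ≠1. *)

theory Defs
  imports "HOL-Probability.Probability"
begin

(* A third-order tensor A of size n1 x n2 x n3 has type real^'n3^'n2^'n1, so that
   A $ i $ j is the tube A(i,j,:) and A $ i $ j $ k is the entry A(i,j,k).  The library
   norm on this type is the Frobenius norm.  The transform is real, so the conjugate
   transpose is the transpose throughout. *)

definition tube_L :: "real^'k^'k \<Rightarrow> real^'k \<Rightarrow> real^'k"
  where "tube_L M a = M *v a"

definition tube_Linv :: "real^'k^'k \<Rightarrow> real^'k \<Rightarrow> real^'k"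
  where "tube_Linv M a = matrix_inv M *v a"

definition tube_prod :: "real^'k^'k \<Rightarrow> real^'k \<Rightarrow> real^'k \<Rightarrow> real^'k"
  where "tube_prod M a b = tube_Linv M (\<chi> k. tube_L M a $ k * tube_L M b $ k)"

definition tensor_L :: "real^'k^'k \<Rightarrow> real^'k^'b^'a \<Rightarrow> real^'k^'b^'a"
  where "tensor_L M A = (\<chi> i j. tube_L M (A $ i $ j))"

definition tensor_Linv :: "real^'k^'k \<Rightarrow> real^'k^'b^'a \<Rightarrow> real^'k^'b^'a"
  where "tensor_Linv M A = (\<chi> i j. tube_Linv M (A $ i $ j))"

definition frontal_slice :: "real^'k^'b^'a \<Rightarrow> 'k \<Rightarrow> real^'b^'a"
  where "frontal_slice A k = (\<chi> i j. A $ i $ j $ k)"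

definition tensor_prod :: "real^'k^'k \<Rightarrow> real^'k^'b^'a \<Rightarrow> real^'k^'d^'b \<Rightarrow> real^'k^'d^'a"
  where "tensor_prod M A B = (\<chi> i j. \<Sum>s\<in>UNIV. tube_prod M (A $ i $ s) (B $ s $ j))"

definition tensor_transpose :: "real^'k^'k \<Rightarrow> real^'k^'b^'a \<Rightarrow> real^'k^'a^'b"
  where "tensor_transpose M A =
    tensor_Linv M (\<chi> i j k. transpose (frontal_slice (tensor_L M A) k) $ i $ j)"

definition tensor_id :: "real^'k^'k \<Rightarrow> real^'k^'a^'a"
  where "tensor_id M = (\<chi> i j. if i = j then tube_Linv M (\<chi> k. 1) else 0)"

definition tensor_inv :: "real^'k^'k \<Rightarrow> real^'k^'a^'a \<Rightarrow> real^'k^'a^'a"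
  where "tensor_inv M A =
    (THE B. tensor_prod M A B = tensor_id M \<and> tensor_prod M B A = tensor_id M)"

definition tensor_column :: "real^'k^'b^'a \<Rightarrow> 'b \<Rightarrow> real^'k^1^'a"
  where "tensor_column U j = (\<chi> i s. U $ i $ j)"

(* The coefficients range over tubes, viewed as 1 x 1 x n3 tensors. *)
definition tensor_column_space :: "real^'k^'k \<Rightarrow> real^'k^'b^'a \<Rightarrow> (real^'k^1^'a) set"
  where "tensor_column_space M U =
    {\<Sum>j\<in>UNIV. tensor_prod M (tensor_column U j) (c j) | c :: 'b \<Rightarrow> real^'k^1^1. True}"

definition tensor_orth_space :: "real^'k^'k \<Rightarrow> real^'k^'b^'a \<Rightarrow> (real^'k^1^'a) set"
  where "tensor_orth_space M U = {Y. tensor_prod M (tensor_transpose M U) Y = 0}"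

definition tensor_proj :: "real^'k^'k \<Rightarrow> real^'k^'b^'a \<Rightarrow> real^'k^'a^'a"
  where "tensor_proj M U =
    tensor_prod M
      (tensor_prod M U (tensor_inv M (tensor_prod M (tensor_transpose M U) U)))
      (tensor_transpose M U)"

(* The coordinates of R^(n1 n3) are indexed by pairs (i,j) instead of by the number
   (j - 1) n1 + i. *)
definition unfold :: "real^'k^1^'a \<Rightarrow> real^('a \<times> 'k)"
  where "unfold T = (\<chi> p. T $ fst p $ 1 $ snd p)"

definition lmat :: "real^'k^'k \<Rightarrow> real^'k^'b^'a \<Rightarrow> real^('b \<times> 'k)^('a \<times> 'k)"
  where "lmat M U = (THE A. \<forall>C :: real^'k^1^'b. unfold (tensor_prod M U C) = A *v unfold C)"

definition orth_proj :: "'v::euclidean_space set \<Rightarrow> 'v \<Rightarrow> 'v"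
  where "orth_proj S v = (THE x. x \<in> S \<and> v - x \<in> orthogonal_comp S)"

definition coherence :: "nat \<Rightarrow> nat \<Rightarrow> (real^'p) set \<Rightarrow> real"
  where "coherence n1 n2 S =
    real n1 / real n2 * Max (range (\<lambda>j. (norm (orth_proj S (axis j 1)))\<^sup>2))"

(* A sample drawn with replacement is a multiset \<Omega> of positions, and m = |\<Omega>| counts
   repeated draws.  Restriction to \<Omega> is zero-filling; an entry or row that is drawn r times
   carries the weight sqrt r, so that sums of squares, Gram matrices and products
   U_\<Omega>^H t_\<Omega> are sums over the m draws.  Without repetitions this is restriction to a set of
   positions, see sample_tensor_distinct and sample_rows_distinct below. *)

definition sample_tensor :: "('a \<times> 'k) multiset \<Rightarrow> real^'k^1^'a \<Rightarrow> real^'k^1^'a"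
  where "sample_tensor \<Omega> T =
    (\<chi> i s j. if (i, j) \<in># \<Omega> then sqrt (real (count \<Omega> (i, j))) * T $ i $ s $ j else 0)"

definition sample_rows :: "'p multiset \<Rightarrow> real^'q^'p \<Rightarrow> real^'q^'p"
  where "sample_rows \<Omega> U =
    (\<chi> p. if p \<in># \<Omega> then sqrt (real (count \<Omega> p)) *\<^sub>R U $ p else 0)"

definition gram :: "real^'q^'p \<Rightarrow> real^'q^'q"
  where "gram A = transpose A ** A"

definition column_proj :: "real^'q^'p \<Rightarrow> real^'p^'p"
  where "column_proj A = A ** matrix_inv (gram A) ** transpose A"

lemma unfold_nth [simp]: "unfold T $ (i, j) = T $ i $ 1 $ j"
  by (simp add: unfold_def)

lemma unfold_surj: "\<exists>T. unfold T = v"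
  by (rule exI[of _ "\<chi> i s j. v $ (i, j)"]) (simp add: unfold_def vec_eq_iff)

lemma linear_tube_prod: "linear (tube_prod M a)"
proof -
  have *: "linear (\<lambda>b. \<chi> k. tube_L M a $ k * tube_L M b $ k)"
    by (rule linearI)
      (simp_all add: vec_eq_iff tube_L_def matrix_vector_right_distrib
        matrix_vector_mult_scaleR algebra_simps)
  show ?thesis
    using linear_compose[OF * matrix_vector_mul_linear[of "matrix_inv M"]]
    by (simp add: tube_prod_def[abs_def] tube_Linv_def o_def)
qed

lemma lmat: "unfold (tensor_prod M U C) = lmat M U *v unfold C"
proof -
  define f where "f v = unfold (tensor_prod M U (\<chi> i s j. v $ (i, j)))" for v
  have add: "(\<chi> j. v $ (i, j) + w $ (i, j)) = (\<chi> j. v $ (i, j)) + (\<chi> j. w $ (i, j))"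
    for v w :: "real^('c \<times> 'b)" and i
    by (simp add: vec_eq_iff)
  have scale: "(\<chi> j. r *\<^sub>R v $ (i, j)) = r *\<^sub>R (\<chi> j. v $ (i, j))"
    for v :: "real^('c \<times> 'b)" and r i
    by (simp add: vec_eq_iff)
  have "linear f"
  proof (rule linearI)
    show "f (v + w) = f v + f w" for v w
    proof -
      have "f (v + w) $ (i, k) = f v $ (i, k) + f w $ (i, k)" for i k
        unfolding f_def tensor_prod_def unfold_nth vec_lambda_beta vector_add_component add
          linear_add[OF linear_tube_prod] sum.distrib vector_add_component ..
      then show ?thesis by (simp add: vec_eq_iff)
    qed
    show "f (r *\<^sub>R v) = r *\<^sub>R f v" for r v
    proof -
      have "f (r *\<^sub>R v) $ (i, k) = r * f v $ (i, k)" for i k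
        unfolding f_def tensor_prod_def unfold_nth vec_lambda_beta vector_scaleR_component scale
          linear_cmul[OF linear_tube_prod] scaleR_sum_right[symmetric] vector_scaleR_component
        by (simp only: real_scaleR_def)
      then show ?thesis by (simp add: vec_eq_iff)
    qed
  qed
  then have matrix_f: "matrix f *v v = f v" for v
    by (simp add: matrix_works linear_matrix_vector_mul_eq)
  have f: "unfold (tensor_prod M U C) = f (unfold C)" for C
  proof -
    have "(\<chi> i s j. unfold C $ (i, j)) = C"
      by (simp add: vec_eq_iff)
    then show ?thesis by (simp add: f_def)
  qed
  have "\<exists>!A. \<forall>C. unfold (tensor_prod M U C) = A *v unfold C"
  proof (rule ex1I[of _ "matrix f"])
    show "\<forall>C. unfold (tensor_prod M U C) = matrix f *v unfold C"
      by (simp add: f matrix_f)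
    show "A = matrix f" if "\<forall>C. unfold (tensor_prod M U C) = A *v unfold C" for A
    proof -
      have "A *v v = matrix f *v v" for v
      proof -
        obtain C where C: "unfold C = v" using unfold_surj by blast
        have "A *v unfold C = f (unfold C)"
          by (rule trans[OF sym[OF spec[OF that]] f])
        then show ?thesis by (simp add: C matrix_f)
      qed
      then show ?thesis by (simp add: matrix_eq)
    qed
  qed
  from theI'[OF this, folded lmat_def] show ?thesis
    by (rule spec)
qed

lemma sample_tensor_distinct:
  assumes "\<And>p. count \<Omega> p \<le> 1"
  shows "sample_tensor \<Omega> T = (\<chi> i s j. if (i, j) \<in> set_mset \<Omega> then T $ i $ s $ j else 0)"
proof -
  have "count \<Omega> p = 1" if "p \<in># \<Omega>" for p
    using that assms[of p] by (metis count_greater_eq_one_iff le_antisym)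
  then show ?thesis by (simp add: sample_tensor_def vec_eq_iff)
qed

lemma sample_rows_distinct:
  assumes "\<And>p. count \<Omega> p \<le> 1"
  shows "sample_rows \<Omega> U = (\<chi> p. if p \<in> set_mset \<Omega> then U $ p else 0)"
proof -
  have "count \<Omega> p = 1" if "p \<in># \<Omega>" for p
    using that assms[of p] by (metis count_greater_eq_one_iff le_antisym)
  then show ?thesis by (simp add: sample_rows_def vec_eq_iff)
qed

lemma sum_count_eq:
  fixes f :: "'p::finite \<Rightarrow> real"
  shows "(\<Sum>p\<in>UNIV. real (count \<Omega> p) * f p) = (\<Sum>p\<in>#\<Omega>. f p)"
proof (induction \<Omega>)
  case (add q \<Omega>)
  have "(\<Sum>p\<in>UNIV. real (count (add_mset q \<Omega>) p) * f p)
      = (\<Sum>p\<in>UNIV. (if p = q then f p else 0) + real (count \<Omega> p) * f p)"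
    by (rule sum.cong) (auto simp: distrib_right)
  with add show ?case by (simp add: sum.distrib)
qed simp

lemma norm_unfold_sample_tensor:
  "(norm (unfold (sample_tensor \<Omega> T)))\<^sup>2 = (\<Sum>p\<in>#\<Omega>. (unfold T $ p)\<^sup>2)"
proof -
  have "(norm (unfold (sample_tensor \<Omega> T)))\<^sup>2 = (\<Sum>p\<in>UNIV. (unfold (sample_tensor \<Omega> T) $ p)\<^sup>2)"
    by (simp add: norm_vec_def L2_set_def sum_nonneg)
  also have "\<dots> = (\<Sum>p\<in>UNIV. real (count \<Omega> p) * (unfold T $ p)\<^sup>2)"
    by (rule sum.cong) (auto simp: unfold_def sample_tensor_def power_mult_distrib not_in_iff)
  finally show ?thesis by (simp add: sum_count_eq)
qed

lemma gram_sample_rows: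
  "gram (sample_rows \<Omega> U) $ a $ b = (\<Sum>p\<in>#\<Omega>. U $ p $ a * U $ p $ b)"
proof -
  have "gram (sample_rows \<Omega> U) $ a $ b = (\<Sum>p\<in>UNIV. real (count \<Omega> p) * (U $ p $ a * U $ p $ b))"
    unfolding gram_def matrix_matrix_mult_def transpose_def vec_lambda_beta
    by (rule sum.cong) (auto simp: sample_rows_def not_in_iff)
  then show ?thesis by (simp add: sum_count_eq)
qed

end

theory Submission
  imports Defs
begin

text \<open>Let \<open>W = lmat M U\<close>, which has orthonormal columns, and let \<open>z\<close> and \<open>G\<close> be the sampled vector
  \<open>y\<^sub>\<Omega>\<close> and the Gram matrix of the sampled rows of \<open>W\<close>.  The residual equals
  \<open>\<parallel>z\<parallel>\<^sup>2 - g \<bullet> G\<^sup>-\<^sup>1 g\<close> with \<open>g = \<Sum> y\<^sub>p W\<^sub>p\<close> over the draws \<open>p\<close>, and four events of probability at most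
  \<open>\<delta>\<close> each have to be excluded.

  Both tails of \<open>\<parallel>z\<parallel>\<^sup>2\<close> come from Bernstein's inequality.  The lower tail with the constant of \<open>\<alpha>\<close>
  alone is false, because \<open>\<parallel>y\<parallel>\<^sup>2 / (n1 n3) - y\<^sub>p\<^sup>2\<close> may exceed \<open>\<parallel>y\<parallel>\<^sub>\<infinity>\<^sup>2 - \<parallel>y\<parallel>\<^sup>2 / (n1 n3)\<close>; the missing
  multiple of \<open>ln (1 / \<delta>)\<close> is taken out of \<open>\<beta>\<close>.  The bound \<open>\<beta>\<close> on \<open>\<parallel>g\<parallel>\<^sup>2\<close> is false as well when \<open>y\<close> is
  too concentrated for the sample size, but then the claimed lower bound is not positive.  Otherwise a
  Hilbert space Bernstein inequality of Pinelis, based on the supermartingale property of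
  \<open>cosh (\<lambda> \<parallel>S\<parallel>)\<close>, gives it with room to spare.

  The smallest eigenvalue of \<open>G\<close> is bounded by the Ahlswede-Winter argument for \<open>trace (exp (- \<theta> G))\<close>.
  Matrix exponentials are avoided: \<open>trace ((I - \<theta> G / q)\<^sup>q)\<close> with \<open>q\<close> a power of two takes their place,
  and the Lieb-Thirring inequality \<open>trace ((A B)\<^sup>q) \<le> trace (A\<^sup>q B\<^sup>q)\<close>, elementary for such \<open>q\<close>, takes
  that of the Golden-Thompson inequality.\<close>

section \<open>Traces of dyadic matrix powers\<close>

primrec mat_pow :: "real^'n^'n \<Rightarrow> nat \<Rightarrow> real^'n^'n" where
  "mat_pow A 0 = mat 1"
| "mat_pow A (Suc k) = A ** mat_pow A k"

lemma mat_pow_add: "mat_pow A (j + k) = mat_pow A j ** mat_pow A k"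
  by (induction j) (simp_all add: matrix_mul_assoc)

lemma mat_pow_Suc_right: "mat_pow A (Suc k) = mat_pow A k ** A"
  using mat_pow_add[of A k 1] by simp

lemma mat_pow_mult: "mat_pow A (j * k) = mat_pow (mat_pow A j) k"
  by (induction k) (simp_all add: mat_pow_add)

lemma mat_pow_double: "mat_pow A (2 ^ Suc k) = mat_pow (A ** A) (2 ^ k)"
  using mat_pow_mult[of A 2 "2 ^ k"] by (simp add: numeral_2_eq_2)

lemma mat_pow_two_power_Suc: "mat_pow A (2 ^ Suc k) = mat_pow A (2 ^ k) ** mat_pow A (2 ^ k)"
  using mat_pow_add[of A "2 ^ k" "2 ^ k"] by (simp add: mult_2)

lemma transpose_mat_pow: "transpose (mat_pow A k) = mat_pow (transpose A) k"
proof (induction k)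
  case (Suc k)
  then show ?case
    using mat_pow_Suc_right[of "transpose A" k] by (simp add: matrix_transpose_mul)
qed simp

lemma trace_mul_transpose: "trace (A ** transpose B) = (A :: real^'n^'n) \<bullet> B"
  by (simp add: trace_def matrix_matrix_mult_def transpose_def inner_vec_def)

text \<open>Moving one factor to the other end gives \<open>(A B)^(i+1) = A (B A)^i B\<close>, after
  which cyclicity of the trace applies.\<close>

lemma trace_cyclic_pow:
  fixes A B :: "real^'n^'n"
  shows "trace (mat_pow (A ** B) k) = trace (mat_pow (B ** A) k)"
proof (cases k)
  case (Suc j)
  have "mat_pow (A ** B) (Suc i) = A ** mat_pow (B ** A) i ** B" for i
    by (induction i) (simp_all add: matrix_mul_assoc)
  then show ?thesis
    using Suc mat_pow_Suc_right[of "B ** A" j]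
      trace_mul_sym[of "A ** mat_pow (B ** A) j" B]
    by (simp add: matrix_mul_assoc)
qed simp

lemma trace_mult_le_norm: "trace (A ** B) \<le> norm A * norm (transpose B :: real^'n^'n)"
  using trace_mul_transpose[of A "transpose B"] norm_cauchy_schwarz[of A "transpose B"] by simp

lemma norm_transpose_square: "(norm A)\<^sup>2 = trace (A ** transpose (A :: real^'n^'n))"
  by (simp add: trace_mul_transpose power2_norm_eq_inner)

lemma norm_transpose: "norm (transpose A) = norm (A :: real^'n^'n)"
proof -
  have "(norm (transpose A))\<^sup>2 = (norm A)\<^sup>2"
    using trace_mul_sym[of A "transpose A"] by (simp add: norm_transpose_square)
  then show ?thesis by simp
qed

text \<open>Cauchy-Schwarz for the Frobenius inner product of \<open>A\<close> and its transpose,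
  which have equal norm. This is the base case of the dyadic induction.\<close>

lemma trace_square_le: "trace (A ** A) \<le> trace (A ** transpose (A :: real^'n^'n))"
  using trace_mult_le_norm[of A A]
  by (simp add: norm_transpose norm_transpose_square[symmetric] power2_eq_square)

text \<open>Both inequalities are proved by a joint induction: the second one at \<open>k\<close> applied to the Gram
  matrices \<open>X\<^sup>T X\<close> and \<open>X X\<^sup>T\<close> lifts the first one from \<open>X\<^sup>2\<close> to \<open>X\<close>.\<close>
lemma trace_dyadic_powers:
  "(\<forall>X :: real^'n^'n. trace (mat_pow X (2 ^ Suc k)) \<le> trace (mat_pow (X ** transpose X) (2 ^ k)))
   \<and> (\<forall>A B :: real^'n^'n. transpose A = A \<longrightarrow> transpose B = B \<longrightarrow>
        trace (mat_pow (A ** B) (2 ^ k)) \<le> trace (mat_pow A (2 ^ k) ** mat_pow B (2 ^ k)))"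
proof (induction k)
  case 0
  show ?case by (simp add: trace_square_le numeral_2_eq_2)
next
  case (Suc k)
  then have W: "\<And>X :: real^'n^'n.
      trace (mat_pow X (2 ^ Suc k)) \<le> trace (mat_pow (X ** transpose X) (2 ^ k))"
    and L: "\<And>A B :: real^'n^'n. transpose A = A \<Longrightarrow> transpose B = B \<Longrightarrow>
        trace (mat_pow (A ** B) (2 ^ k)) \<le> trace (mat_pow A (2 ^ k) ** mat_pow B (2 ^ k))"
    by blast+
  show ?case
  proof (intro conjI allI impI)
    fix X :: "real^'n^'n"
    define P where "P = transpose X ** X"
    define Q where "Q = X ** transpose X"
    have sym: "transpose P = P" "transpose Q = Q"
      by (simp_all add: P_def Q_def matrix_transpose_mul)
    \<comment> \<open>The traces of equal powers of \<open>P\<close> and \<open>Q\<close> agree, so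
      that Cauchy-Schwarz applied to \<open>Q^(2^k) P^(2^k)\<close> returns a power of
      \<open>Q\<close> alone.\<close>
    have normPQ: "norm (mat_pow P (2 ^ k)) = norm (mat_pow Q (2 ^ k))"
    proof -
      have "(norm (mat_pow P (2 ^ k)))\<^sup>2 = (norm (mat_pow Q (2 ^ k)))\<^sup>2"
        using trace_cyclic_pow[of "transpose X" X "2 ^ Suc k"]
        by (simp only: norm_transpose_square transpose_mat_pow sym mat_pow_two_power_Suc[symmetric])
          (simp add: P_def Q_def)
      then show ?thesis by simp
    qed
    have "trace (mat_pow X (2 ^ Suc (Suc k))) = trace (mat_pow (X ** X) (2 ^ Suc k))"
      by (simp only: mat_pow_double)
    also have "\<dots> \<le> trace (mat_pow ((X ** X) ** transpose (X ** X)) (2 ^ k))"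
      by (rule W)
    also have "\<dots> = trace (mat_pow (X ** (Q ** transpose X)) (2 ^ k))"
      by (simp add: Q_def matrix_transpose_mul matrix_mul_assoc)
    also have "\<dots> = trace (mat_pow (Q ** P) (2 ^ k))"
      by (subst trace_cyclic_pow) (simp add: P_def matrix_mul_assoc)
    also have "\<dots> \<le> trace (mat_pow Q (2 ^ k) ** mat_pow P (2 ^ k))"
      by (rule L[OF sym(2,1)])
    also have "\<dots> \<le> norm (mat_pow Q (2 ^ k)) * norm (mat_pow P (2 ^ k))"
      using trace_mult_le_norm[of "mat_pow Q (2 ^ k)" "mat_pow P (2 ^ k)"]
      by (simp add: norm_transpose)
    also have "\<dots> = trace (mat_pow Q (2 ^ Suc k))"
      using norm_transpose_square[of "mat_pow Q (2 ^ k)"]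
      by (simp only: normPQ mat_pow_two_power_Suc transpose_mat_pow sym power2_eq_square)
    finally show "trace (mat_pow X (2 ^ Suc (Suc k)))
        \<le> trace (mat_pow (X ** transpose X) (2 ^ Suc k))"
      by (simp only: Q_def)
  next
    fix A B :: "real^'n^'n"
    assume A: "transpose A = A" and B: "transpose B = B"
    have "trace (mat_pow (A ** B) (2 ^ Suc k))
        \<le> trace (mat_pow ((A ** B) ** transpose (A ** B)) (2 ^ k))"
      by (rule W)
    also have "\<dots> = trace (mat_pow (A ** (B ** B ** A)) (2 ^ k))"
      by (simp add: A B matrix_transpose_mul matrix_mul_assoc)
    also have "\<dots> = trace (mat_pow ((B ** B) ** (A ** A)) (2 ^ k))"
      by (subst trace_cyclic_pow) (simp add: matrix_mul_assoc)
    also have "\<dots> = trace (mat_pow ((A ** A) ** (B ** B)) (2 ^ k))"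
      by (rule trace_cyclic_pow)
    also have "\<dots> \<le> trace (mat_pow (A ** A) (2 ^ k) ** mat_pow (B ** B) (2 ^ k))"
      by (rule L) (simp_all add: A B matrix_transpose_mul)
    finally show "trace (mat_pow (A ** B) (2 ^ Suc k))
        \<le> trace (mat_pow A (2 ^ Suc k) ** mat_pow B (2 ^ Suc k))"
      by (simp only: mat_pow_double)
  qed
qed

lemma Lieb_Thirring_dyadic:
  fixes A B :: "real^'n^'n"
  assumes "transpose A = A" "transpose B = B"
  shows "trace (mat_pow (A ** B) (2 ^ k)) \<le> trace (mat_pow A (2 ^ k) ** mat_pow B (2 ^ k))"
  using trace_dyadic_powers assms by blast

section \<open>Exponential tail bounds for uniform draws with replacement\<close>

abbreviation uniform_draws :: "nat \<Rightarrow> 'b::finite list pmf" where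
  "uniform_draws m \<equiv> replicate_pmf m (pmf_of_set UNIV)"

lemma finite_set_uniform_draws: "finite (set_pmf (uniform_draws m :: 'b::finite list pmf))"
  using finite_lists_length_eq[of "UNIV :: 'b set" m] by (simp add: set_replicate_pmf)

lemma expectation_uniform_draws_Suc:
  fixes f :: "'b::finite list \<Rightarrow> real"
  shows "measure_pmf.expectation (uniform_draws (Suc m)) f
    = (\<Sum>x\<in>UNIV. measure_pmf.expectation (uniform_draws m) (\<lambda>xs. f (x # xs))) / CARD('b)"
proof -
  have *: "uniform_draws (Suc m)
      = pmf_of_set UNIV \<bind> (\<lambda>x. map_pmf (Cons x) (uniform_draws m :: 'b list pmf))"
    by (simp add: map_pmf_def)
  show ?thesis
    unfolding *
    by (subst pmf_expectation_bind[of UNIV])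
      (simp_all add: finite_set_uniform_draws sum_divide_distrib)
qed

lemma expectation_uniform_draws_mono:
  fixes f g :: "'b::finite list \<Rightarrow> real"
  assumes "\<And>xs. f xs \<le> g xs"
  shows "measure_pmf.expectation (uniform_draws m) f \<le> measure_pmf.expectation (uniform_draws m) g"
  by (intro integral_mono integrable_measure_pmf_finite finite_set_uniform_draws assms)

text \<open>The averaged one-step estimate is applied to the first entry of the list, the remaining
  entries playing the part of the past. This is the supermartingale argument without
  filtrations.\<close>

lemma expectation_uniform_draws_le:
  fixes f :: "'b::finite list \<Rightarrow> real" and \<rho> :: real
  assumes "\<And>xs. (\<Sum>x\<in>UNIV. f (x # xs)) / CARD('b) \<le> \<rho> * f xs" "\<rho> \<ge> 0"
  shows "measure_pmf.expectation (uniform_draws m) f \<le> \<rho> ^ m * f []"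
proof (induction m)
  case (Suc m)
  have "measure_pmf.expectation (uniform_draws (Suc m)) f
      = measure_pmf.expectation (uniform_draws m) (\<lambda>xs. (\<Sum>x\<in>UNIV. f (x # xs)) / CARD('b))"
    unfolding expectation_uniform_draws_Suc
    by (simp add: Bochner_Integration.integral_sum integrable_measure_pmf_finite
        finite_set_uniform_draws)
  also have "\<dots> \<le> measure_pmf.expectation (uniform_draws m) (\<lambda>xs. \<rho> * f xs)"
    by (rule expectation_uniform_draws_mono) (rule assms)
  also have "\<dots> \<le> \<rho> * (\<rho> ^ m * f [])"
    using Suc assms(2) by (simp add: mult_left_mono)
  finally show ?case by simp
qed simp

text \<open>Markov's inequality for the finitely supported law of the draws.\<close>

lemma prob_uniform_draws_le:
  fixes f :: "'b::finite list \<Rightarrow> real" and c :: real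
  assumes "\<And>xs. 0 \<le> f xs" "\<And>xs. P xs \<Longrightarrow> c \<le> f xs" "0 < c"
  shows "measure_pmf.prob (uniform_draws m) {xs. P xs}
    \<le> measure_pmf.expectation (uniform_draws m) f / c"
proof -
  have "measure_pmf.prob (uniform_draws m) {xs. P xs}
      = measure_pmf.expectation (uniform_draws m) (indicator {xs. P xs})"
    by simp
  also have "\<dots> \<le> measure_pmf.expectation (uniform_draws m) (\<lambda>xs. f xs / c)"
    by (rule expectation_uniform_draws_mono)
      (use assms in \<open>auto simp: indicator_def field_simps\<close>)
  finally show ?thesis by simp
qed

section \<open>Bernstein's inequality for real summands\<close>

lemma exp_le_quadratic:
  fixes x :: real
  assumes "x < 3"
  shows "exp x \<le> 1 + x + x\<^sup>2 / (2 * (1 - x / 3))"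
proof -
  \<comment> \<open>The claim is \<open>h x \<ge> 0\<close> divided by \<open>1 - x / 3\<close>.
    Since \<open>h' = k / 3\<close>, \<open>k 0 = 0\<close> and \<open>k\<close> is nondecreasing,
    \<open>h\<close> has its minimum at 0, where it vanishes.\<close>
  define k where "k x = 2 + x + exp x * (x - 2)" for x :: real
  define h where "h x = x\<^sup>2 / 2 - (1 - x / 3) * (exp x - 1 - x)" for x :: real
  have k': "(k has_real_derivative 1 + exp x * (x - 1)) (at x)" for x
    unfolding k_def by (auto intro!: derivative_eq_intros simp: algebra_simps)
  have k'_nonneg: "0 \<le> 1 + exp x * (x - 1)" for x :: real
  proof -
    have "exp x * (1 - x) \<le> exp x * exp (- x)"
      using exp_ge_add_one_self[of "- x"] by (intro mult_left_mono) auto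
    then show ?thesis by (simp add: exp_minus field_simps)
  qed
  have k_mono: "k x \<le> k y" if "x \<le> y" for x y
    by (rule DERIV_nonneg_imp_nondecreasing[OF that]) (use k' k'_nonneg in blast)
  have h': "(h has_real_derivative k x / 3) (at x)" for x
    unfolding h_def k_def by (auto intro!: derivative_eq_intros simp: field_simps)
  have k0: "k 0 = 0" by (simp add: k_def)
  have "h 0 \<le> h x"
  proof (cases "0 \<le> x")
    case True
    show ?thesis
    proof (rule DERIV_nonneg_imp_nondecreasing[OF True])
      show "\<exists>y'. (h has_real_derivative y') (at y) \<and> 0 \<le> y'" if "0 \<le> y" for y
        using h'[of y] k_mono[OF that] k0 by (intro exI[of _ "k y / 3"]) simp
    qed
  next
    case False
    then have "x \<le> 0" by simp
    then show ?thesis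
    proof (rule DERIV_nonpos_imp_nonincreasing)
      show "\<exists>y'. (h has_real_derivative y') (at y) \<and> y' \<le> 0" if "y \<le> 0" for y
        using h'[of y] k_mono[OF that] k0 by (intro exI[of _ "k y / 3"]) simp
    qed
  qed
  then have "(exp x - 1 - x) * (1 - x / 3) \<le> x\<^sup>2 / 2"
    by (simp add: h_def mult.commute)
  then have "exp x - 1 - x \<le> (x\<^sup>2 / 2) / (1 - x / 3)"
    using assms by (subst pos_le_divide_eq) auto
  then show ?thesis by simp
qed

lemma exp_le_quadratic_bounded:
  fixes x b :: real
  assumes "x \<le> b" "b < 3"
  shows "exp x \<le> 1 + x + x\<^sup>2 / (2 * (1 - b / 3))"
proof -
  have "x\<^sup>2 / (2 * (1 - x / 3)) \<le> x\<^sup>2 / (2 * (1 - b / 3))"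
    using assms by (intro divide_left_mono mult_pos_pos) auto
  then show ?thesis using exp_le_quadratic[of x] assms by linarith
qed

text \<open>Markov's inequality for the exponential of \<open>l\<close> times the sum. The linear
  term of the quadratic bound on the exponential averages to zero, so one draw contributes at most a
  factor \<open>exp w\<close>.\<close>

lemma Bernstein_exponential:
  fixes Z :: "'b::finite \<Rightarrow> real" and b v l t :: real and m :: nat
  assumes mean: "(\<Sum>x\<in>UNIV. Z x) = 0" and bound: "\<And>x. Z x \<le> b"
    and var: "(\<Sum>x\<in>UNIV. (Z x)\<^sup>2) / CARD('b) \<le> v"
    and l: "0 \<le> l" "l * b < 3"
  shows "measure_pmf.prob (uniform_draws m) {xs. t \<le> sum_list (map Z xs)}
    \<le> exp (- l * t + m * (v * l\<^sup>2 / (2 * (1 - l * b / 3))))"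
proof -
  define f where "f xs = exp (l * sum_list (map Z xs))" for xs
  define w where "w = v * l\<^sup>2 / (2 * (1 - l * b / 3))"
  have avg: "(\<Sum>x\<in>UNIV. exp (l * Z x)) / CARD('b) \<le> exp w"
  proof -
    have "(\<Sum>x\<in>UNIV. exp (l * Z x))
        \<le> (\<Sum>x\<in>UNIV. 1 + l * Z x + l\<^sup>2 * (Z x)\<^sup>2 / (2 * (1 - l * b / 3)))"
    proof (rule sum_mono)
      fix x
      show "exp (l * Z x) \<le> 1 + l * Z x + l\<^sup>2 * (Z x)\<^sup>2 / (2 * (1 - l * b / 3))"
        using exp_le_quadratic_bounded[of "l * Z x" "l * b"] l bound[of x]
        by (simp add: mult_left_mono power_mult_distrib)
    qed
    also have "\<dots> = CARD('b) + l\<^sup>2 / (2 * (1 - l * b / 3)) * (\<Sum>x\<in>UNIV. (Z x)\<^sup>2)"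
      by (simp add: sum.distrib mean sum_distrib_left[symmetric] sum_divide_distrib[symmetric])
    finally have "(\<Sum>x\<in>UNIV. exp (l * Z x)) / CARD('b)
        \<le> (CARD('b) + l\<^sup>2 / (2 * (1 - l * b / 3)) * (\<Sum>x\<in>UNIV. (Z x)\<^sup>2)) / CARD('b)"
      by (rule divide_right_mono) simp
    also have "\<dots> = 1 + l\<^sup>2 / (2 * (1 - l * b / 3)) * ((\<Sum>x\<in>UNIV. (Z x)\<^sup>2) / CARD('b))"
      by (simp add: add_divide_distrib)
    also have "\<dots> \<le> 1 + l\<^sup>2 / (2 * (1 - l * b / 3)) * v"
      using l by (intro add_left_mono mult_left_mono var divide_nonneg_nonneg mult_nonneg_nonneg) auto
    also have "\<dots> = 1 + w" by (simp add: w_def)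
    also have "\<dots> \<le> exp w" by (rule exp_ge_add_one_self)
    finally show ?thesis .
  qed
  have "measure_pmf.prob (uniform_draws m) {xs. t \<le> sum_list (map Z xs)}
      \<le> measure_pmf.expectation (uniform_draws m) f / exp (l * t)"
    by (rule prob_uniform_draws_le) (auto simp: f_def intro: mult_left_mono l)
  also have "\<dots> \<le> exp w ^ m * f [] / exp (l * t)"
  proof (intro divide_right_mono expectation_uniform_draws_le)
    fix xs
    have "(\<Sum>x\<in>UNIV. f (x # xs)) / CARD('b) = (\<Sum>x\<in>UNIV. exp (l * Z x)) / CARD('b) * f xs"
      by (simp add: f_def distrib_left exp_add sum_distrib_right)
    also have "\<dots> \<le> exp w * f xs"
      by (rule mult_right_mono[OF avg]) (simp add: f_def)
    finally show "(\<Sum>x\<in>UNIV. f (x # xs)) / CARD('b) \<le> exp w * f xs" .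
  qed simp_all
  also have "\<dots> = exp (- l * t + m * w)"
    by (simp add: f_def exp_diff exp_of_nat_mult)
  finally show ?thesis by (simp add: w_def)
qed

lemma Bernstein:
  fixes Z :: "'b::finite \<Rightarrow> real" and b v L :: real and m :: nat
  assumes mean: "(\<Sum>x\<in>UNIV. Z x) = 0" and bound: "\<And>x. Z x \<le> b"
    and var: "(\<Sum>x\<in>UNIV. (Z x)\<^sup>2) / CARD('b) \<le> v"
    and pos: "0 < v" "0 \<le> b" "0 < m" "0 \<le> L"
  shows "measure_pmf.prob (uniform_draws m)
      {xs. sqrt (2 * L * m * v) + 2 * b * L / 3 \<le> sum_list (map Z xs)} \<le> exp (- L)"
proof -
  define t where "t = sqrt (2 * L * m * v) + 2 * b * L / 3"
  define s where "s = m * v + b * t / 3"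
  \<comment> \<open>The usual Bernstein parameter: it turns \<open>1 - l * b / 3\<close> into
    \<open>m * v / s\<close> and collapses the exponent to \<open>- t^2 / (2 * s)\<close>.\<close>
  define l where "l = t / s"
  have t: "0 \<le> t" using pos by (simp add: t_def)
  have mv: "0 < m * v" using pos by simp
  have s: "0 < s" using pos t mv by (simp add: s_def add_pos_nonneg)
  have lb: "1 - l * b / 3 = m * v / s"
  proof -
    have "1 - l * b / 3 = (s - b * t / 3) / s"
      using s by (simp add: l_def diff_divide_distrib mult.commute)
    then show ?thesis by (simp add: s_def)
  qed
  \<comment> \<open>The linear term of \<open>t\<close> is made for this:
    \<open>t * (t - 2 * b * L / 3)\<close> is \<open>t\<close> times the square root in
    \<open>t\<close>, hence at least the square of that root.\<close>
  have quad: "2 * L * s \<le> t\<^sup>2"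
  proof -
    have q: "(sqrt (2 * L * m * v))\<^sup>2 = 2 * L * m * v" using pos by simp
    have "t\<^sup>2 - 2 * L * b * t / 3 = t * sqrt (2 * L * m * v)"
      by (simp add: t_def power2_eq_square field_simps)
    also have "\<dots> \<ge> (sqrt (2 * L * m * v))\<^sup>2"
      unfolding power2_eq_square using pos by (intro mult_right_mono) (auto simp: t_def)
    finally show ?thesis unfolding q by (simp add: s_def algebra_simps)
  qed
  have "measure_pmf.prob (uniform_draws m) {xs. t \<le> sum_list (map Z xs)}
      \<le> exp (- l * t + m * (v * l\<^sup>2 / (2 * (1 - l * b / 3))))"
  proof (rule Bernstein_exponential[OF mean bound var])
    show "0 \<le> l" using t s by (simp add: l_def)
    have "0 < 1 - l * b / 3" unfolding lb using mv s by simp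
    then show "l * b < 3" by simp
  qed
  also have "- l * t + m * (v * l\<^sup>2 / (2 * (1 - l * b / 3))) = - t\<^sup>2 / (2 * s)"
    unfolding lb using s pos by (simp add: l_def field_simps power2_eq_square)
  also have "exp (- t\<^sup>2 / (2 * s)) \<le> exp (- L)"
    using quad s by (simp add: field_simps)
  finally show ?thesis by (simp add: t_def)
qed

section \<open>Pinelis' inequality for vector summands\<close>

lemma convex_power: "convex_on {0 :: real..} (\<lambda>x. x ^ n)"
  using convex_power_even[of n] convex_power_odd[of n] by (cases "even n") (auto elim: convex_on_subset)

lemma sinh_ge_self:
  fixes x :: real
  assumes "0 \<le> x"
  shows "x \<le> sinh x"
proof -
  have "sinh 0 - 0 \<le> sinh x - x"
  proof (rule DERIV_nonneg_imp_nondecreasing[OF assms])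
    fix y :: real
    have "((\<lambda>x. sinh x - x) has_real_derivative cosh y - 1) (at y)"
      by (auto intro!: derivative_eq_intros)
    then show "\<exists>z. ((\<lambda>x. sinh x - x) has_real_derivative z) (at y) \<and> 0 \<le> z"
      using cosh_real_ge_1[of y] by (intro exI[of _ "cosh y - 1"]) simp
  qed
  then show ?thesis by simp
qed

text \<open>The power series of cosh runs over powers of the squared argument with nonnegative
  coefficients, so cosh is a convex function of that square. The comparison is made term by
  term.\<close>

lemma cosh_convex_square:
  fixes p q r \<tau> :: real
  assumes "r\<^sup>2 = (1 - \<tau>) * p\<^sup>2 + \<tau> * q\<^sup>2" "0 \<le> \<tau>" "\<tau> \<le> 1"
  shows "cosh r \<le> (1 - \<tau>) * cosh p + \<tau> * cosh q"
proof (rule sums_le)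
  let ?c = "\<lambda>x n. if even n then x ^ n /\<^sub>R fact n else (0 :: real)"
  show "?c r sums cosh r" by (rule cosh_converges)
  show "(\<lambda>n. (1 - \<tau>) * ?c p n + \<tau> * ?c q n) sums ((1 - \<tau>) * cosh p + \<tau> * cosh q)"
    by (intro sums_add sums_mult cosh_converges)
  show "?c r n \<le> (1 - \<tau>) * ?c p n + \<tau> * ?c q n" for n
  proof (cases "even n")
    case True
    then obtain k where n: "n = 2 * k" by (elim evenE)
    have "((1 - \<tau>) * p\<^sup>2 + \<tau> * q\<^sup>2) ^ k \<le> (1 - \<tau>) * (p\<^sup>2) ^ k + \<tau> * (q\<^sup>2) ^ k"
      using convex_onD[OF convex_power[of k], of \<tau> "p\<^sup>2" "q\<^sup>2"] assms(2,3) by simp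
    then have "r ^ n \<le> (1 - \<tau>) * p ^ n + \<tau> * q ^ n"
      by (simp add: n power_mult assms(1))
    then have "inverse (fact n) * r ^ n \<le> inverse (fact n) * ((1 - \<tau>) * p ^ n + \<tau> * q ^ n)"
      by (intro mult_left_mono) auto
    then show ?thesis using True by (simp add: algebra_simps)
  qed simp
qed

text \<open>Writing \<open>x \<bullet> v = s \<parallel>x\<parallel> \<parallel>v\<parallel>\<close>, convexity in \<open>s\<close> of the left-hand side reduces the bound to
  parallel \<open>x\<close> and \<open>v\<close>.  The term linear in \<open>v\<close> drops out when \<open>v\<close> is averaged to zero.\<close>
lemma cosh_norm_add_le:
  fixes x v :: "'v::real_inner"
  shows "cosh (norm (v + x)) \<le> cosh (norm x) * (exp (norm v) - norm v)
      + sinh (norm x) / norm x * (x \<bullet> v)"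
proof (cases "x = 0 \<or> v = 0")
  case True
  have "cosh (norm v) + norm v \<le> exp (norm v)"
    using sinh_ge_self[of "norm v"] cosh_plus_sinh[of "norm v"] by simp
  with True show ?thesis by auto
next
  case False
  define a b s where "a = norm x" and "b = norm v" and "s = (x \<bullet> v) / (a * b)"
  have ab: "0 < a" "0 < b" using False by (simp_all add: a_def b_def)
  have "\<bar>x \<bullet> v\<bar> \<le> a * b" by (simp add: a_def b_def Cauchy_Schwarz_ineq2)
  then have s: "-1 \<le> s" "s \<le> 1" using ab by (simp_all add: s_def field_simps abs_le_iff)
  have xv: "x \<bullet> v = s * a * b" using ab by (simp add: s_def)
  define \<tau> where "\<tau> = (1 + s) / 2"
  have "(norm (v + x))\<^sup>2 = b\<^sup>2 + a\<^sup>2 + 2 * (x \<bullet> v)"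
    by (simp add: a_def b_def power2_norm_eq_inner inner_simps inner_commute)
  also have "\<dots> = (1 - \<tau>) * (a - b)\<^sup>2 + \<tau> * (a + b)\<^sup>2"
    by (simp add: xv \<tau>_def power2_eq_square field_simps)
  finally have "cosh (norm (v + x)) \<le> (1 - \<tau>) * cosh (a - b) + \<tau> * cosh (a + b)"
    by (rule cosh_convex_square) (use s in \<open>auto simp: \<tau>_def\<close>)
  also have "\<dots> = cosh a * cosh b + s * sinh a * sinh b"
    by (simp add: cosh_add cosh_diff \<tau>_def field_simps)
  also have "\<dots> = cosh a * cosh b + s * sinh a * b + s * sinh a * (sinh b - b)"
    by (simp add: algebra_simps)
  \<comment> \<open>Only the excess of \<open>sinh b\<close> over \<open>b\<close> is estimated;
    \<open>s * sinh a * b\<close> is kept exactly, being the term linear in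
    \<open>v\<close>.\<close>
  also have "s * sinh a * (sinh b - b) \<le> cosh a * (sinh b - b)"
  proof (rule mult_right_mono)
    have "s * sinh a \<le> 1 * sinh a" using s ab by (intro mult_right_mono) auto
    also have "\<dots> \<le> cosh a" using exp_ge_zero[of "- a"] by (simp add: cosh_minus_sinh[symmetric])
    finally show "s * sinh a \<le> cosh a" .
    show "0 \<le> sinh b - b" using sinh_ge_self[of b] ab by simp
  qed
  also have "cosh a * cosh b + s * sinh a * b + cosh a * (sinh b - b)
      = cosh a * (exp b - b) + sinh a / a * (x \<bullet> v)"
    using ab cosh_plus_sinh[of b] by (simp add: xv algebra_simps) (simp add: distrib_left[symmetric])
  finally show ?thesis by (simp add: a_def b_def)
qed

text \<open>On average one draw multiplies \<open>cosh\<close> of \<open>l\<close> times the norm of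
  the sum by at most \<open>exp w\<close>, because the linear terms cancel. The factor 2 comes from
  bounding \<open>cosh\<close> below by half the exponential.\<close>

lemma Pinelis:
  fixes V :: "'b::finite \<Rightarrow> 'v::real_inner" and b v l t :: real and m :: nat
  assumes mean: "(\<Sum>x\<in>UNIV. V x) = 0" and bound: "\<And>x. norm (V x) \<le> b"
    and var: "(\<Sum>x\<in>UNIV. (norm (V x))\<^sup>2) / CARD('b) \<le> v"
    and l: "0 \<le> l" "l * b < 3"
  shows "measure_pmf.prob (uniform_draws m) {xs. t \<le> norm (sum_list (map V xs))}
    \<le> 2 * exp (- l * t + m * (v * l\<^sup>2 / (2 * (1 - l * b / 3))))"
proof (cases "0 \<le> t")
  \<comment> \<open>The comparison of values of \<open>cosh\<close> in the other case needs
    \<open>t \<ge> 0\<close>. For negative \<open>t\<close> the exponent is nonnegative and the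
    bound is trivial.\<close>
  case False
  have "0 \<le> v" using var by (rule order_trans[rotated]) (simp add: sum_nonneg)
  then have "0 \<le> v * l\<^sup>2 / (2 * (1 - l * b / 3))"
    using l by (intro divide_nonneg_nonneg mult_nonneg_nonneg) auto
  moreover have "l * t \<le> 0" using False l by (simp add: mult_nonneg_nonpos)
  ultimately have "0 \<le> - l * t + m * (v * l\<^sup>2 / (2 * (1 - l * b / 3)))"
    by (metis add_nonneg_nonneg minus_mult_left neg_0_le_iff_le mult_nonneg_nonneg of_nat_0_le_iff)
  then have "1 \<le> exp (- l * t + m * (v * l\<^sup>2 / (2 * (1 - l * b / 3))))" by simp
  then show ?thesis
    using measure_pmf.prob_le_1[of "uniform_draws m" "{xs. t \<le> norm (sum_list (map V xs))}"]
    by linarith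
next
  case True
  define f where "f xs = cosh (norm (l *\<^sub>R sum_list (map V xs)))" for xs
  define w where "w = v * l\<^sup>2 / (2 * (1 - l * b / 3))"
  have avg: "(\<Sum>x\<in>UNIV. exp (norm (l *\<^sub>R V x)) - norm (l *\<^sub>R V x)) / CARD('b) \<le> exp w"
  proof -
    have "(\<Sum>x\<in>UNIV. exp (norm (l *\<^sub>R V x)) - norm (l *\<^sub>R V x))
        \<le> (\<Sum>x\<in>UNIV. 1 + l\<^sup>2 * (norm (V x))\<^sup>2 / (2 * (1 - l * b / 3)))"
    proof (rule sum_mono)
      fix x
      show "exp (norm (l *\<^sub>R V x)) - norm (l *\<^sub>R V x)
          \<le> 1 + l\<^sup>2 * (norm (V x))\<^sup>2 / (2 * (1 - l * b / 3))"
        using exp_le_quadratic_bounded[of "l * norm (V x)" "l * b"] l bound[of x]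
        by (simp add: mult_left_mono power_mult_distrib)
    qed
    also have "\<dots> = CARD('b) + l\<^sup>2 / (2 * (1 - l * b / 3)) * (\<Sum>x\<in>UNIV. (norm (V x))\<^sup>2)"
      by (simp add: sum.distrib sum_distrib_left[symmetric] sum_divide_distrib[symmetric])
    finally have "(\<Sum>x\<in>UNIV. exp (norm (l *\<^sub>R V x)) - norm (l *\<^sub>R V x)) / CARD('b)
        \<le> (CARD('b) + l\<^sup>2 / (2 * (1 - l * b / 3)) * (\<Sum>x\<in>UNIV. (norm (V x))\<^sup>2)) / CARD('b)"
      by (rule divide_right_mono) simp
    also have "\<dots> = 1 + l\<^sup>2 / (2 * (1 - l * b / 3)) * ((\<Sum>x\<in>UNIV. (norm (V x))\<^sup>2) / CARD('b))"
      by (simp add: add_divide_distrib)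
    also have "\<dots> \<le> 1 + l\<^sup>2 / (2 * (1 - l * b / 3)) * v"
      using l by (intro add_left_mono mult_left_mono var divide_nonneg_nonneg mult_nonneg_nonneg) auto
    also have "\<dots> = 1 + w" by (simp add: w_def)
    also have "\<dots> \<le> exp w" by (rule exp_ge_add_one_self)
    finally show ?thesis .
  qed
  have "measure_pmf.prob (uniform_draws m) {xs. t \<le> norm (sum_list (map V xs))}
      \<le> measure_pmf.expectation (uniform_draws m) f / (exp (l * t) / 2)"
  proof (rule prob_uniform_draws_le)
    show "exp (l * t) / 2 \<le> f xs" if "t \<le> norm (sum_list (map V xs))" for xs
    proof -
      have "exp (l * t) / 2 \<le> cosh (l * t)"
        using exp_gt_zero[of "- (l * t)"] by (simp add: cosh_field_def)
      also have "\<dots> \<le> f xs"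
        using that l True by (simp add: f_def cosh_real_nonneg_le_iff mult_left_mono)
      finally show ?thesis .
    qed
  qed (simp_all add: f_def cosh_real_nonneg)
  also have "\<dots> \<le> exp w ^ m * f [] / (exp (l * t) / 2)"
  proof (intro divide_right_mono expectation_uniform_draws_le)
    fix xs
    let ?S = "l *\<^sub>R sum_list (map V xs)"
    have "(\<Sum>x\<in>UNIV. f (x # xs))
        \<le> (\<Sum>x\<in>UNIV. cosh (norm ?S) * (exp (norm (l *\<^sub>R V x)) - norm (l *\<^sub>R V x))
             + sinh (norm ?S) / norm ?S * (?S \<bullet> (l *\<^sub>R V x)))"
      unfolding f_def using cosh_norm_add_le[of "l *\<^sub>R V _" ?S]
      by (intro sum_mono) (simp add: scaleR_add_right)
    also have "\<dots> = cosh (norm ?S) * (\<Sum>x\<in>UNIV. exp (norm (l *\<^sub>R V x)) - norm (l *\<^sub>R V x))"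
      unfolding sum.distrib sum_distrib_left[symmetric] inner_sum_right[symmetric]
        scaleR_sum_right[symmetric] mean by simp
    finally have "(\<Sum>x\<in>UNIV. f (x # xs)) / CARD('b) \<le> cosh (norm ?S)
        * ((\<Sum>x\<in>UNIV. exp (norm (l *\<^sub>R V x)) - norm (l *\<^sub>R V x)) / CARD('b))"
      by (simp add: divide_right_mono)
    also have "\<dots> \<le> cosh (norm ?S) * exp w"
      by (rule mult_left_mono[OF avg]) (simp add: cosh_real_nonneg)
    finally show "(\<Sum>x\<in>UNIV. f (x # xs)) / CARD('b) \<le> exp w * f xs"
      by (simp add: f_def mult.commute)
  qed simp_all
  also have "\<dots> = 2 * exp (- l * t + m * w)"
    by (simp add: f_def exp_diff exp_of_nat_mult)
  finally show ?thesis by (simp add: w_def)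
qed

section \<open>A matrix Chernoff bound\<close>

definition outer :: "real^'n \<Rightarrow> real^'n^'n" where
  "outer u = (\<chi> i j. u $ i * u $ j)"

lemma transpose_outer: "transpose (outer u) = outer u"
  by (simp add: outer_def transpose_def mult.commute)

lemma transpose_add: "transpose (A + B) = transpose A + transpose B"
  by (simp add: transpose_def vec_eq_iff)

lemma transpose_diff: "transpose (A - B :: real^'n^'m) = transpose A - transpose B"
  by (simp add: transpose_def vec_eq_iff)

lemma outer_mult_outer: "outer u ** outer u = (norm u)\<^sup>2 *\<^sub>R outer u"
  by (simp add: outer_def matrix_matrix_mult_def vec_eq_iff power2_norm_eq_inner inner_vec_def
      sum_distrib_left sum_distrib_right algebra_simps)

lemma outer_mult_vec: "outer u *v v = (u \<bullet> v) *\<^sub>R u"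
  by (simp add: outer_def matrix_vector_mult_def vec_eq_iff inner_vec_def
      sum_distrib_left sum_distrib_right algebra_simps)

lemma trace_mult_outer: "trace (A ** outer u) = u \<bullet> (A *v u)"
  by (simp add: outer_def trace_def matrix_matrix_mult_def matrix_vector_mult_def inner_vec_def
      sum_distrib_left algebra_simps)

lemma trace_scaleR: "trace (a *\<^sub>R A :: real^'n^'n) = a * trace A"
  by (simp add: trace_def sum_distrib_left)

lemma matrix_mult_sum_right: "A ** (\<Sum>x\<in>X. B x) = (\<Sum>x\<in>X. A ** B x :: real^'n^'n)"
  by (induction X rule: infinite_finite_induct) (simp_all add: matrix_add_ldistrib)

lemma trace_sum: "trace (\<Sum>x\<in>X. B x) = (\<Sum>x\<in>X. trace (B x :: real^'n^'n))"
  by (simp add: trace_def) (rule sum.swap)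

lemma matrix_diff_rdistrib: "(A - B) ** C = A ** C - B ** (C :: real^'n^'m)"
  by (simp add: matrix_matrix_mult_def vec_eq_iff left_diff_distrib sum_subtractf)

lemma matrix_diff_ldistrib: "A ** (B - C) = A ** B - A ** (C :: real^'n^'m)"
  by (simp add: matrix_matrix_mult_def vec_eq_iff right_diff_distrib sum_subtractf)

text \<open>The square of \<open>outer u\<close> is a multiple of \<open>outer u\<close>, so powers
  stay in the span of the identity and \<open>outer u\<close>. The coefficient is left as a
  geometric sum, which avoids dividing by the norm of \<open>u\<close> and keeps its monotonicity
  visible.\<close>

lemma mat_pow_rank_one:
  "mat_pow (mat 1 - \<eta> *\<^sub>R outer u) q
    = mat 1 - (\<Sum>i<q. \<eta> * (1 - \<eta> * (norm u)\<^sup>2) ^ i) *\<^sub>R outer u"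
proof (induction q)
  case (Suc q)
  define c where "c = (\<Sum>i<q. \<eta> * (1 - \<eta> * (norm u)\<^sup>2) ^ i)"
  have "mat_pow (mat 1 - \<eta> *\<^sub>R outer u) (Suc q)
      = (mat 1 - \<eta> *\<^sub>R outer u) ** (mat 1 - c *\<^sub>R outer u)"
    by (simp only: mat_pow.simps Suc c_def)
  also have "\<dots> = mat 1 - (\<eta> + (1 - \<eta> * (norm u)\<^sup>2) * c) *\<^sub>R outer u"
    by (simp add: matrix_diff_ldistrib matrix_diff_rdistrib scalar_matrix_assoc[symmetric]
        matrix_scalar_ac outer_mult_outer) (simp add: algebra_simps)
  also have "\<eta> + (1 - \<eta> * (norm u)\<^sup>2) * c = (\<Sum>i<Suc q. \<eta> * (1 - \<eta> * (norm u)\<^sup>2) ^ i)"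
    by (simp only: sum.lessThan_Suc_shift c_def sum_distrib_left) (simp add: algebra_simps)
  finally show ?case .
qed simp

lemma norm_matrix_vector_mult_le:
  fixes A :: "real^'n^'m"
  shows "norm (A *v v) \<le> norm A * norm v"
proof -
  have "(norm (A *v v))\<^sup>2 = (\<Sum>i\<in>UNIV. (A $ i \<bullet> v)\<^sup>2)"
    unfolding power2_norm_eq_inner inner_vec_def[of "A *v v"] matrix_vector_mul_component
    by (simp add: power2_eq_square)
  also have "\<dots> \<le> (\<Sum>i\<in>UNIV. (A $ i \<bullet> A $ i) * (v \<bullet> v))"
    by (intro sum_mono Cauchy_Schwarz_ineq)
  also have "\<dots> = (norm A * norm v)\<^sup>2"
    by (simp add: power_mult_distrib power2_norm_eq_inner inner_vec_def[of A] sum_distrib_right)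
  finally show ?thesis by (rule power2_le_imp_le) simp
qed

lemma symmetric_inner_swap:
  fixes A :: "real^'n^'n"
  assumes "transpose A = A"
  shows "u \<bullet> (A *v v) = (A *v u) \<bullet> v"
  using dot_lmul_matrix[of u A v] assms transpose_matrix_vector[of A u] by simp

lemma quadratic_form_even_power:
  fixes A :: "real^'n^'n"
  assumes "transpose A = A"
  shows "v \<bullet> (mat_pow A (2 ^ Suc k) *v v) = (norm (mat_pow A (2 ^ k) *v v))\<^sup>2"
proof -
  have "transpose (mat_pow A (2 ^ k)) = mat_pow A (2 ^ k)"
    by (simp add: transpose_mat_pow assms)
  from symmetric_inner_swap[OF this, of v "mat_pow A (2 ^ k) *v v"] show ?thesis
    by (simp only: mat_pow_two_power_Suc matrix_vector_mul_assoc[symmetric] power2_norm_eq_inner)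
qed

text \<open>Repeated squaring: by Cauchy-Schwarz and symmetry, the square of the form of
  \<open>A^(2^k)\<close> at a unit vector is at most the form of \<open>A^(2^(k+1))\<close>. No
  spectral decomposition enters.\<close>

lemma quadratic_form_power_ge:
  fixes A :: "real^'n^'n"
  assumes A: "transpose A = A" and v: "norm v = 1" and nn: "0 \<le> v \<bullet> (A *v v)"
  shows "(v \<bullet> (A *v v)) ^ (2 ^ k) \<le> v \<bullet> (mat_pow A (2 ^ k) *v v)"
proof (induction k)
  case (Suc k)
  have "(v \<bullet> (A *v v)) ^ (2 ^ Suc k) = ((v \<bullet> (A *v v)) ^ (2 ^ k))\<^sup>2"
    by (simp add: power_mult[symmetric] mult.commute)
  also have "\<dots> \<le> (v \<bullet> (mat_pow A (2 ^ k) *v v))\<^sup>2"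
    using Suc nn by (intro power_mono) auto
  also have "\<dots> \<le> (norm (mat_pow A (2 ^ k) *v v))\<^sup>2"
    using Cauchy_Schwarz_ineq2[of v "mat_pow A (2 ^ k) *v v"] v
    by (simp add: abs_le_square_iff[symmetric])
  finally show ?case by (simp only: quadratic_form_even_power[OF A])
qed simp

text \<open>The trace of an even power of a symmetric matrix is the squared Frobenius norm of the
  half power, and this norm dominates the image of any unit vector. The trace thus detects a single
  direction.\<close>

lemma trace_power_ge:
  fixes A :: "real^'n^'n"
  assumes A: "transpose A = A" and v: "norm v = 1" and nn: "0 \<le> v \<bullet> (A *v v)"
  shows "(v \<bullet> (A *v v)) ^ (2 ^ Suc k) \<le> trace (mat_pow A (2 ^ Suc k))"
proof -
  have "(v \<bullet> (A *v v)) ^ (2 ^ Suc k) \<le> (norm (mat_pow A (2 ^ k) *v v))\<^sup>2"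
    using quadratic_form_power_ge[OF assms, of "Suc k"] by (simp only: quadratic_form_even_power[OF A])
  also have "\<dots> \<le> (norm (mat_pow A (2 ^ k)))\<^sup>2"
    using norm_matrix_vector_mult_le[of "mat_pow A (2 ^ k)" v] v by (intro power_mono) auto
  also have "\<dots> = trace (mat_pow A (2 ^ Suc k))"
    by (simp only: norm_transpose_square transpose_mat_pow A mat_pow_two_power_Suc)
  finally show ?thesis .
qed

section \<open>Error of the Trotter product\<close>

lemma mat_pow_bound:
  fixes A :: "real^'n^'n" and c :: real
  assumes "\<And>v. norm (A *v v) \<le> c * norm v" "0 \<le> c"
  shows "norm (mat_pow A q *v v) \<le> c ^ q * norm v"
proof (induction q)
  case (Suc q)
  have "norm (mat_pow A (Suc q) *v v) \<le> c * norm (mat_pow A q *v v)"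
    by (simp add: matrix_vector_mul_assoc[symmetric] assms)
  also have "\<dots> \<le> c * (c ^ q * norm v)"
    by (rule mult_left_mono[OF Suc assms(2)])
  finally show ?case by (simp add: mult.assoc)
qed simp

text \<open>Telescoping through
  \<open>A^(q+1) - B^(q+1) = A (A^q - B^q) + (A - B) B^q\<close>.\<close>

lemma mat_pow_diff_bound:
  fixes A B :: "real^'n^'n" and c e :: real
  assumes A: "\<And>v. norm (A *v v) \<le> c * norm v" and B: "\<And>v. norm (B *v v) \<le> c * norm v"
    and AB: "\<And>v. norm ((A - B) *v v) \<le> e * norm v" and c: "1 \<le> c" "0 \<le> e"
  shows "norm ((mat_pow A q - mat_pow B q) *v v) \<le> q * c ^ q * e * norm v"
proof (induction q)
  case (Suc q)
  have "(mat_pow A (Suc q) - mat_pow B (Suc q)) *v v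
      = A *v ((mat_pow A q - mat_pow B q) *v v) + (A - B) *v (mat_pow B q *v v)"
    by (simp add: matrix_vector_mult_diff_rdistrib matrix_vector_mult_diff_distrib
        matrix_vector_mul_assoc[symmetric])
  also have "norm \<dots> \<le> c * norm ((mat_pow A q - mat_pow B q) *v v) + e * norm (mat_pow B q *v v)"
    by (rule norm_triangle_le) (intro add_mono A AB)
  also have "\<dots> \<le> c * (q * c ^ q * e * norm v) + e * (c ^ q * norm v)"
    using c by (intro add_mono mult_left_mono Suc mat_pow_bound B) auto
  also have "\<dots> \<le> c * (q * c ^ q * e * norm v) + c * (e * (c ^ q * norm v))"
    using c mult_right_mono[of 1 c "e * (c ^ q * norm v)"] by simp
  also have "\<dots> = Suc q * c ^ Suc q * e * norm v"
    by (simp add: algebra_simps)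
  finally show ?case .
qed simp

lemma abs_trace_le:
  fixes A :: "real^'n^'n" and c :: real
  assumes "\<And>v. norm (A *v v) \<le> c * norm v"
  shows "\<bar>trace A\<bar> \<le> CARD('n) * c"
proof -
  have "\<bar>A $ i $ i\<bar> \<le> c" for i
  proof -
    have "A $ i $ i = (A *v axis i 1) $ i"
      by (simp add: matrix_vector_mult_basis column_def)
    also have "\<bar>\<dots>\<bar> \<le> norm (A *v axis i 1)" by (rule component_le_norm_cart)
    also have "\<dots> \<le> c" using assms[of "axis i 1"] by simp
    finally show ?thesis .
  qed
  then have "(\<Sum>i\<in>UNIV. \<bar>A $ i $ i\<bar>) \<le> CARD('n) * c"
    using sum_mono[of UNIV "\<lambda>i. \<bar>A $ i $ i\<bar>" "\<lambda>_. c"] by simp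
  then show ?thesis unfolding trace_def using sum_abs[of "\<lambda>i. A $ i $ i" UNIV] by linarith
qed

lemma norm_id_minus_scaled_le:
  fixes S :: "real^'n^'n" and \<eta> :: real
  shows "norm ((mat 1 - \<eta> *\<^sub>R S) *v v) \<le> (1 + \<bar>\<eta>\<bar> * norm S) * norm v"
proof -
  have "norm ((mat 1 - \<eta> *\<^sub>R S) *v v) = norm (v - \<eta> *\<^sub>R (S *v v))"
    by (simp add: matrix_vector_mult_diff_rdistrib scaleR_matrix_vector_assoc)
  also have "\<dots> \<le> norm v + \<bar>\<eta>\<bar> * norm (S *v v)"
    using norm_triangle_ineq4[of v "\<eta> *\<^sub>R (S *v v)"] by simp
  also have "\<dots> \<le> norm v + \<bar>\<eta>\<bar> * (norm S * norm v)"
    by (intro add_left_mono mult_left_mono norm_matrix_vector_mult_le) simp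
  finally show ?thesis by (simp add: algebra_simps)
qed

text \<open>The two matrices raised to the power \<open>q\<close> differ by
  \<open>(\<theta> / q)^2 S X\<close> only. Over \<open>q\<close> factors this leaves an error of
  order \<open>1 / q\<close>, while the accumulated operator bounds stay below an exponential that
  is independent of \<open>q\<close>.\<close>

lemma Trotter_trace_bound:
  fixes S X :: "real^'n^'n" and q :: nat and \<theta> :: real
  assumes q: "0 < q" and \<theta>: "0 \<le> \<theta>"
  shows "\<bar>trace (mat_pow ((mat 1 - (\<theta> / q) *\<^sub>R S) ** (mat 1 - (\<theta> / q) *\<^sub>R X)) q)
          - trace (mat_pow (mat 1 - (\<theta> / q) *\<^sub>R (S + X)) q)\<bar>
    \<le> CARD('n) * exp (2 * \<theta> * (norm S + norm X)) * \<theta>\<^sup>2 * norm S * norm X / q"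
proof -
  define \<eta> where "\<eta> = \<theta> / q"
  define h where "h = 1 + \<eta> * (norm S + norm X)"
  define A where "A = (mat 1 - \<eta> *\<^sub>R S) ** (mat 1 - \<eta> *\<^sub>R X)"
  define B where "B = mat 1 - \<eta> *\<^sub>R (S + X)"
  have \<eta>: "0 \<le> \<eta>" using \<theta> by (simp add: \<eta>_def)
  have h: "1 \<le> h" using \<eta> by (simp add: h_def)
  then have h2: "h \<le> h\<^sup>2" by (simp add: self_le_power)
  have S: "norm ((mat 1 - \<eta> *\<^sub>R S) *v v) \<le> h * norm v" for v
    by (rule order_trans[OF norm_id_minus_scaled_le])
      (use \<eta> in \<open>auto simp: h_def intro!: mult_right_mono mult_left_mono\<close>)
  have X: "norm ((mat 1 - \<eta> *\<^sub>R X) *v v) \<le> h * norm v" for v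
    by (rule order_trans[OF norm_id_minus_scaled_le])
      (use \<eta> in \<open>auto simp: h_def intro!: mult_right_mono mult_left_mono\<close>)
  have A_bound: "norm (A *v v) \<le> h\<^sup>2 * norm v" for v
  proof -
    have "norm (A *v v) \<le> h * norm ((mat 1 - \<eta> *\<^sub>R X) *v v)"
      by (simp only: A_def matrix_vector_mul_assoc[symmetric] S)
    also have "\<dots> \<le> h * (h * norm v)" using h by (intro mult_left_mono X) auto
    finally show ?thesis by (simp add: power2_eq_square mult.assoc)
  qed
  have B_bound: "norm (B *v v) \<le> h\<^sup>2 * norm v" for v
  proof -
    have "norm (B *v v) \<le> (1 + \<bar>\<eta>\<bar> * norm (S + X)) * norm v"
      unfolding B_def by (rule norm_id_minus_scaled_le)
    also have "\<dots> \<le> h * norm v"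
      using \<eta> norm_triangle_ineq[of S X]
      by (auto simp: h_def intro!: mult_right_mono mult_left_mono)
    also have "\<dots> \<le> h\<^sup>2 * norm v" by (intro mult_right_mono h2) simp
    finally show ?thesis .
  qed
  have "(A - B) *v v = \<eta>\<^sup>2 *\<^sub>R (S *v (X *v v))" for v
    by (simp add: A_def B_def matrix_vector_mul_assoc[symmetric] matrix_vector_mult_diff_rdistrib
        matrix_vector_mult_diff_distrib matrix_vector_mult_add_rdistrib scaleR_add_right
        scaleR_matrix_vector_assoc[symmetric] matrix_vector_mult_scaleR power2_eq_square algebra_simps)
  then have AB: "norm ((A - B) *v v) \<le> \<eta>\<^sup>2 * norm S * norm X * norm v" for v
  proof -
    have "norm (S *v (X *v v)) \<le> norm S * norm (X *v v)"
      by (rule norm_matrix_vector_mult_le)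
    also have "\<dots> \<le> norm S * (norm X * norm v)"
      by (intro mult_left_mono norm_matrix_vector_mult_le) simp
    finally have "\<eta>\<^sup>2 * norm (S *v (X *v v)) \<le> \<eta>\<^sup>2 * (norm S * (norm X * norm v))"
      by (intro mult_left_mono) auto
    then show ?thesis by (simp add: \<open>(A - B) *v v = _\<close> mult.assoc)
  qed
  have diff: "norm ((mat_pow A q - mat_pow B q) *v v)
      \<le> q * (h\<^sup>2) ^ q * (\<eta>\<^sup>2 * norm S * norm X) * norm v" for v
    by (rule mat_pow_diff_bound[OF A_bound B_bound AB]) (use h in auto)
  have "\<bar>trace (mat_pow A q - mat_pow B q)\<bar>
      \<le> CARD('n) * (q * (h\<^sup>2) ^ q * (\<eta>\<^sup>2 * norm S * norm X))"
    by (rule abs_trace_le) (rule diff)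
  also have "\<dots> \<le> CARD('n) * (q * exp (2 * \<theta> * (norm S + norm X)) * (\<eta>\<^sup>2 * norm S * norm X))"
  proof (intro mult_left_mono mult_right_mono)
    have "h ^ (2 * q) \<le> exp (\<eta> * (norm S + norm X)) ^ (2 * q)"
      unfolding h_def using \<eta> by (intro power_mono) auto
    also have "\<dots> = exp (2 * \<theta> * (norm S + norm X))"
      unfolding exp_of_nat_mult[symmetric] using q by (simp add: \<eta>_def)
    finally show "(h\<^sup>2) ^ q \<le> exp (2 * \<theta> * (norm S + norm X))" by (simp add: power_mult)
  qed auto
  also have "\<dots> = CARD('n) * exp (2 * \<theta> * (norm S + norm X)) * \<theta>\<^sup>2 * norm S * norm X / q"
    using q by (simp add: \<eta>_def power2_eq_square)
  finally show ?thesis by (simp add: A_def B_def \<eta>_def trace_sub)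
qed

text \<open>One step of the Ahlswede-Winter argument. Lieb-Thirring separates \<open>K\<close> from
  the drawn rank one factor, whose power is the identity minus a multiple of
  \<open>outer (u p)\<close>; averaging over \<open>p\<close> turns the outer products into a
  multiple of the identity.\<close>

lemma averaged_trace_power_le:
  fixes u :: "'b::finite \<Rightarrow> real^'n" and K :: "real^'n^'n" and r \<theta> :: real
  assumes K: "transpose K = K" and iso: "(\<Sum>p\<in>UNIV. outer (u p)) = mat 1"
    and r: "\<And>p. (norm (u p))\<^sup>2 \<le> r" "0 < r" and \<theta>: "0 \<le> \<theta>" "\<theta> * r \<le> 2 ^ Suc k"
  shows "(\<Sum>p\<in>UNIV. trace (mat_pow (K ** (mat 1 - (\<theta> / 2 ^ Suc k) *\<^sub>R outer (u p))) (2 ^ Suc k)))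
      / CARD('b)
    \<le> (1 - (1 - exp (- \<theta> * r)) / (r * CARD('b))) * trace (mat_pow K (2 ^ Suc k))"
proof -
  define q where "q = (2 :: nat) ^ Suc k"
  define \<eta> where "\<eta> = \<theta> / q"
  define Q where "Q = mat_pow K q"
  define c where "c x = (\<Sum>i<q. \<eta> * (1 - \<eta> * x) ^ i)" for x
  have q: "0 < q" by (simp add: q_def)
  have \<eta>: "0 \<le> \<eta>" "\<eta> * r \<le> 1" using \<theta> by (simp_all add: \<eta>_def q_def)
  \<comment> \<open>The exponent is even, so \<open>Q\<close> is positive semidefinite whatever the
    signs of the eigenvalues of \<open>K\<close>. This allows the coefficient of
    \<open>u p \<bullet> (Q *v u p)\<close> to be lowered.\<close>
  have Q_nonneg: "0 \<le> v \<bullet> (Q *v v)" for v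
    unfolding Q_def q_def by (simp only: quadratic_form_even_power[OF K]) simp
  \<comment> \<open>By \<open>\<eta> * r \<le> 1\<close> the bases of the geometric sum stay
    nonnegative, and there its terms decrease with the squared norm.\<close>
  have c_mono: "c r \<le> c ((norm (u p))\<^sup>2)" for p
    unfolding c_def
    by (intro sum_mono mult_left_mono power_mono diff_left_mono \<eta> r) (use \<eta> in simp)
  \<comment> \<open>The geometric sum at \<open>r\<close> evaluates to
    \<open>(1 - (1 - \<eta> * r)^q) / r\<close>, and the power is at most
    \<open>exp (- \<theta> * r)\<close>.\<close>
  have c_r: "(1 - exp (- \<theta> * r)) / r \<le> c r"
  proof -
    have "r * c r = 1 - (1 - \<eta> * r) ^ q"
      using one_diff_power_eq[of "1 - \<eta> * r" q]
      by (simp add: c_def sum_distrib_left[symmetric] algebra_simps)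
    moreover have "(1 - \<eta> * r) ^ q \<le> exp (- (\<eta> * r)) ^ q"
      using \<eta> exp_ge_add_one_self[of "- (\<eta> * r)"] by (intro power_mono) auto
    moreover have "exp (- (\<eta> * r)) ^ q = exp (- \<theta> * r)"
      unfolding exp_of_nat_mult[symmetric] using q by (simp add: \<eta>_def)
    ultimately have "1 - exp (- \<theta> * r) \<le> r * c r" by linarith
    then show ?thesis using r(2) by (simp add: field_simps)
  qed
  have total: "(\<Sum>p\<in>UNIV. u p \<bullet> (Q *v u p)) = trace Q"
  proof -
    have "(\<Sum>p\<in>UNIV. u p \<bullet> (Q *v u p)) = trace (Q ** (\<Sum>p\<in>UNIV. outer (u p)))"
      by (simp add: trace_mult_outer[symmetric] trace_sum matrix_mult_sum_right)
    then show ?thesis by (simp add: iso)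
  qed
  have "trace (mat_pow (K ** (mat 1 - \<eta> *\<^sub>R outer (u p))) q)
      \<le> trace Q - (1 - exp (- \<theta> * r)) / r * (u p \<bullet> (Q *v u p))" for p
  proof -
    have "trace (mat_pow (K ** (mat 1 - \<eta> *\<^sub>R outer (u p))) q)
        \<le> trace (Q ** mat_pow (mat 1 - \<eta> *\<^sub>R outer (u p)) q)"
      unfolding Q_def q_def
      by (rule Lieb_Thirring_dyadic[OF K]) (simp add: transpose_diff transpose_scalar transpose_outer)
    also have "\<dots> = trace (Q ** mat 1 - Q ** (c ((norm (u p))\<^sup>2) *\<^sub>R outer (u p)))"
      by (simp only: mat_pow_rank_one c_def[symmetric] matrix_diff_ldistrib)
    also have "\<dots> = trace Q - c ((norm (u p))\<^sup>2) * (u p \<bullet> (Q *v u p))"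
      by (simp add: trace_sub matrix_scalar_ac trace_scaleR trace_mult_outer
          scalar_matrix_assoc[symmetric])
    also have "\<dots> \<le> trace Q - (1 - exp (- \<theta> * r)) / r * (u p \<bullet> (Q *v u p))"
      by (intro diff_left_mono mult_right_mono Q_nonneg order_trans[OF c_r c_mono])
    finally show ?thesis .
  qed
  then have "(\<Sum>p\<in>UNIV. trace (mat_pow (K ** (mat 1 - \<eta> *\<^sub>R outer (u p))) q))
      \<le> (\<Sum>p\<in>UNIV. trace Q - (1 - exp (- \<theta> * r)) / r * (u p \<bullet> (Q *v u p)))"
    by (rule sum_mono)
  also have "\<dots> = CARD('b) * trace Q - (1 - exp (- \<theta> * r)) / r * trace Q"
    unfolding sum_subtractf sum_distrib_left[symmetric] total by simp
  finally have "(\<Sum>p\<in>UNIV. trace (mat_pow (K ** (mat 1 - \<eta> *\<^sub>R outer (u p))) q)) / CARD('b)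
      \<le> (CARD('b) * trace Q - (1 - exp (- \<theta> * r)) / r * trace Q) / CARD('b)"
    by (rule divide_right_mono) simp
  also have "\<dots> = (1 - (1 - exp (- \<theta> * r)) / (r * CARD('b))) * trace Q"
    by (simp add: diff_divide_distrib left_diff_distrib)
  finally show ?thesis by (simp add: \<eta>_def q_def Q_def)
qed

section \<open>The trace estimate over all draws\<close>

definition sum_outer :: "('b \<Rightarrow> real^'n) \<Rightarrow> 'b list \<Rightarrow> real^'n^'n" where
  "sum_outer u xs = sum_list (map (\<lambda>p. outer (u p)) xs)"

lemma sum_outer_simps [simp]:
  "sum_outer u [] = 0" "sum_outer u (p # xs) = outer (u p) + sum_outer u xs"
  by (simp_all add: sum_outer_def)

lemma transpose_sum_outer: "transpose (sum_outer u xs) = sum_outer u xs"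
  by (induction xs) (simp_all add: transpose_add transpose_outer, simp add: transpose_def vec_eq_iff)

lemma quadratic_form_sum_outer:
  "v \<bullet> (sum_outer u xs *v v) = (\<Sum>p\<leftarrow>xs. (u p \<bullet> v)\<^sup>2)"
  by (induction xs) (simp_all add: matrix_vector_mult_add_rdistrib outer_mult_vec inner_add_right
      inner_commute power2_eq_square)

text \<open>The trace of \<open>exp (- \<theta> S)\<close>, approximated by a power of two of a matrix affine in \<open>S\<close>.\<close>
definition dyadic_trace_exp :: "real \<Rightarrow> nat \<Rightarrow> real^'n^'n \<Rightarrow> real" where
  "dyadic_trace_exp \<theta> k S = trace (mat_pow (mat 1 - (\<theta> / 2 ^ Suc k) *\<^sub>R S) (2 ^ Suc k))"

lemma eventually_less_dyadic: "\<forall>\<^sub>F k in sequentially. (a :: real) < 2 ^ Suc k"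
proof -
  obtain j where j: "a < 2 ^ j" using real_arch_pow[of 2 a] by auto
  show ?thesis
  proof (rule eventually_sequentiallyI)
    fix k assume "j \<le> k"
    then have "(2 :: real) ^ j \<le> 2 ^ Suc k" by (intro power_increasing) auto
    with j show "a < 2 ^ Suc k" by linarith
  qed
qed

text \<open>The law of the draws has finite support, so a pointwise limit passes through the
  expectation term by term.\<close>

lemma expectation_tendsto_zero:
  fixes f :: "nat \<Rightarrow> 'b::finite list \<Rightarrow> real"
  assumes "\<And>xs. (\<lambda>k. f k xs) \<longlonglongrightarrow> 0"
  shows "(\<lambda>k. measure_pmf.expectation (uniform_draws m) (f k)) \<longlonglongrightarrow> 0"
proof -
  have "measure_pmf.expectation (uniform_draws m) (f k)
      = (\<Sum>xs\<in>set_pmf (uniform_draws m). f k xs * pmf (uniform_draws m) xs)" for k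
    by (rule integral_measure_pmf_real[OF finite_set_uniform_draws])
  then show ?thesis
    by (simp only:) (rule tendsto_null_sum, rule tendsto_mult_left_zero, rule assms)
qed

lemma Trotter_error_tendsto_zero:
  fixes S X :: "real^'n^'n"
  assumes \<theta>: "0 \<le> \<theta>"
  shows "(\<lambda>k. trace (mat_pow ((mat 1 - (\<theta> / 2 ^ Suc k) *\<^sub>R S) ** (mat 1 - (\<theta> / 2 ^ Suc k) *\<^sub>R X)) (2 ^ Suc k))
      - dyadic_trace_exp \<theta> k (S + X)) \<longlonglongrightarrow> 0"
proof (rule Lim_null_comparison)
  define C where "C = CARD('n) * exp (2 * \<theta> * (norm S + norm X)) * \<theta>\<^sup>2 * norm S * norm X"
  show "\<forall>\<^sub>F k in sequentially. norm (trace (mat_pow ((mat 1 - (\<theta> / 2 ^ Suc k) *\<^sub>R S) ** (mat 1 - (\<theta> / 2 ^ Suc k) *\<^sub>R X)) (2 ^ Suc k))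
      - dyadic_trace_exp \<theta> k (S + X)) \<le> C * (1 / 2) ^ Suc k"
  proof (rule always_eventually, rule allI)
    fix k :: nat
    show "norm (trace (mat_pow ((mat 1 - (\<theta> / 2 ^ Suc k) *\<^sub>R S) ** (mat 1 - (\<theta> / 2 ^ Suc k) *\<^sub>R X)) (2 ^ Suc k))
      - dyadic_trace_exp \<theta> k (S + X)) \<le> C * (1 / 2) ^ Suc k"
      using Trotter_trace_bound[of "2 ^ Suc k" \<theta> S X] \<theta>
      unfolding C_def dyadic_trace_exp_def real_norm_def power_one_over by simp
  qed
  have "(\<lambda>k. C * (1 / 2) ^ Suc k) \<longlonglongrightarrow> C * 0"
    by (intro tendsto_mult_left LIMSEQ_Suc LIMSEQ_power_zero) simp
  then show "(\<lambda>k. C * (1 / 2) ^ Suc k) \<longlonglongrightarrow> 0" by simp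
qed

text \<open>Every draw costs a factor \<open>\<rho>\<close> and a Trotter error that vanishes as
  \<open>k\<close> grows. For fixed \<open>m\<close> these errors accumulate to a null sequence;
  only its limit matters, hence the existential quantifier.\<close>

lemma expectation_dyadic_trace_exp:
  fixes u :: "'b::finite \<Rightarrow> real^'n" and r \<theta> \<rho> :: real
  assumes iso: "(\<Sum>p\<in>UNIV. outer (u p)) = mat 1"
    and r: "\<And>p. (norm (u p))\<^sup>2 \<le> r" "0 < r" and \<theta>: "0 \<le> \<theta>"
    and \<rho>: "\<rho> = 1 - (1 - exp (- \<theta> * r)) / (r * CARD('b))" "0 \<le> \<rho>"
  shows "\<exists>e. e \<longlonglongrightarrow> 0 \<and> (\<forall>\<^sub>F k in sequentially.
    measure_pmf.expectation (uniform_draws m) (\<lambda>xs. dyadic_trace_exp \<theta> k (sum_outer u xs))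
      \<le> \<rho> ^ m * CARD('n) + e k)"
proof (induction m)
  case 0
  have "mat_pow (mat 1 :: real^'n^'n) j = mat 1" for j by (induction j) simp_all
  then show ?case by (intro exI[of _ "\<lambda>_. 0"]) (simp add: dyadic_trace_exp_def trace_I)
next
  case (Suc m)
  then obtain e where e: "e \<longlonglongrightarrow> 0" "\<forall>\<^sub>F k in sequentially.
    measure_pmf.expectation (uniform_draws m) (\<lambda>xs. dyadic_trace_exp \<theta> k (sum_outer u xs))
      \<le> \<rho> ^ m * CARD('n) + e k" by blast
  define g where "g k xs p = trace (mat_pow ((mat 1 - (\<theta> / 2 ^ Suc k) *\<^sub>R sum_outer u xs)
      ** (mat 1 - (\<theta> / 2 ^ Suc k) *\<^sub>R outer (u p))) (2 ^ Suc k))" for k xs p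
  \<comment> \<open>Merging the factors affine in the old sum and in the new outer product into one
    affine in their sum costs a Trotter error; \<open>err\<close> is its average over the new
    draw.\<close>
  define err where "err k xs = (\<Sum>p\<in>UNIV. dyadic_trace_exp \<theta> k (sum_outer u xs + outer (u p)) - g k xs p)
      / CARD('b)" for k xs
  define e' where "e' k = \<rho> * e k + measure_pmf.expectation (uniform_draws m) (err k)" for k
  have err: "(\<lambda>k. err k xs) \<longlonglongrightarrow> 0" for xs
  proof -
    have "(\<lambda>k. - (g k xs p - dyadic_trace_exp \<theta> k (sum_outer u xs + outer (u p)))) \<longlonglongrightarrow> - 0" for p
      unfolding g_def by (intro tendsto_minus Trotter_error_tendsto_zero \<theta>)
    then have "(\<lambda>k. dyadic_trace_exp \<theta> k (sum_outer u xs + outer (u p)) - g k xs p) \<longlonglongrightarrow> 0" for p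
      by simp
    then have "(\<lambda>k. \<Sum>p\<in>UNIV. dyadic_trace_exp \<theta> k (sum_outer u xs + outer (u p)) - g k xs p) \<longlonglongrightarrow> 0"
      by (intro tendsto_null_sum)
    then show ?thesis unfolding err_def by (rule tendsto_divide_zero)
  qed
  have "e' \<longlonglongrightarrow> \<rho> * 0 + 0"
    unfolding e'_def by (intro tendsto_add tendsto_mult_left e expectation_tendsto_zero err)
  moreover have "\<forall>\<^sub>F k in sequentially. \<theta> * r \<le> 2 ^ Suc k"
  using eventually_less_dyadic[of "\<theta> * r"] by eventually_elim simp
  then have "\<forall>\<^sub>F k in sequentially.
      measure_pmf.expectation (uniform_draws (Suc m)) (\<lambda>xs. dyadic_trace_exp \<theta> k (sum_outer u xs))
      \<le> \<rho> ^ Suc m * CARD('n) + e' k"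
    using e(2)
  proof eventually_elim
    case (elim k)
    note int = integrable_measure_pmf_finite[OF finite_set_uniform_draws]
    have "measure_pmf.expectation (uniform_draws (Suc m)) (\<lambda>xs. dyadic_trace_exp \<theta> k (sum_outer u xs))
        = measure_pmf.expectation (uniform_draws m)
            (\<lambda>xs. (\<Sum>p\<in>UNIV. dyadic_trace_exp \<theta> k (sum_outer u xs + outer (u p))) / CARD('b))"
      unfolding expectation_uniform_draws_Suc
      by (simp add: Bochner_Integration.integral_sum int add.commute)
    also have "\<dots> = measure_pmf.expectation (uniform_draws m)
            (\<lambda>xs. (\<Sum>p\<in>UNIV. g k xs p) / CARD('b) + err k xs)"
      by (simp add: err_def sum_subtractf add_divide_distrib[symmetric])
    also have "\<dots> \<le> measure_pmf.expectation (uniform_draws m)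
            (\<lambda>xs. \<rho> * dyadic_trace_exp \<theta> k (sum_outer u xs) + err k xs)"
    proof (rule expectation_uniform_draws_mono, rule add_right_mono)
      fix xs
      show "(\<Sum>p\<in>UNIV. g k xs p) / CARD('b) \<le> \<rho> * dyadic_trace_exp \<theta> k (sum_outer u xs)"
        unfolding g_def dyadic_trace_exp_def \<rho>(1)
        by (rule averaged_trace_power_le[OF _ iso r \<theta> elim(1)])
          (simp add: transpose_diff transpose_scalar transpose_sum_outer)
    qed
    also have "\<dots> = \<rho> * measure_pmf.expectation (uniform_draws m) (\<lambda>xs. dyadic_trace_exp \<theta> k (sum_outer u xs))
        + measure_pmf.expectation (uniform_draws m) (err k)"
      by (simp add: Bochner_Integration.integral_add int)
    also have "\<dots> \<le> \<rho> * (\<rho> ^ m * CARD('n) + e k) + measure_pmf.expectation (uniform_draws m) (err k)"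
      by (intro add_right_mono mult_left_mono elim \<rho>)
    finally show ?case by (simp add: e'_def algebra_simps)
  qed
  ultimately show ?case by auto
qed

text \<open>Markov's inequality for the dyadic trace at a fixed large \<open>k\<close>, followed by
  the limit in \<open>k\<close>. A unit vector with small quadratic form forces the trace to be at
  least \<open>w k\<close>, which tends to \<open>exp (- (\<theta> * s))\<close>.\<close>

lemma prob_small_quadratic_form_le:
  fixes u :: "'b::finite \<Rightarrow> real^'n" and r \<theta> \<rho> s :: real
  assumes iso: "(\<Sum>p\<in>UNIV. outer (u p)) = mat 1"
    and r: "\<And>p. (norm (u p))\<^sup>2 \<le> r" "0 < r" and \<theta>: "0 \<le> \<theta>"
    and \<rho>: "\<rho> = 1 - (1 - exp (- \<theta> * r)) / (r * CARD('b))" "0 \<le> \<rho>"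
  shows "measure_pmf.prob (uniform_draws m)
      {xs. \<exists>v. norm v = 1 \<and> (\<Sum>p\<leftarrow>xs. (u p \<bullet> v)\<^sup>2) \<le> s} \<le> CARD('n) * \<rho> ^ m * exp (\<theta> * s)"
proof -
  let ?P = "\<lambda>xs. \<exists>v. norm v = 1 \<and> (\<Sum>p\<leftarrow>xs. (u p \<bullet> v)\<^sup>2) \<le> s"
  obtain e where e: "e \<longlonglongrightarrow> 0" "\<forall>\<^sub>F k in sequentially.
    measure_pmf.expectation (uniform_draws m) (\<lambda>xs. dyadic_trace_exp \<theta> k (sum_outer u xs))
      \<le> \<rho> ^ m * CARD('n) + e k"
    using expectation_dyadic_trace_exp[OF iso r \<theta> \<rho>] by blast
  define w where "w k = (1 - \<theta> * s / 2 ^ Suc k) ^ (2 ^ Suc k)" for k :: nat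
  have w: "w \<longlonglongrightarrow> exp (- (\<theta> * s))"
  proof -
    have "strict_mono (\<lambda>k. 2 ^ Suc k :: nat)"
      by (rule strict_monoI) (simp add: power_strict_increasing)
    from LIMSEQ_subseq_LIMSEQ[OF tendsto_exp_limit_sequentially[of "- (\<theta> * s)"] this]
    show ?thesis by (simp add: w_def[abs_def] o_def)
  qed
  have "\<forall>\<^sub>F k in sequentially. \<theta> * s < 2 ^ Suc k"
    by (rule eventually_less_dyadic)
  then have "\<forall>\<^sub>F k in sequentially. measure_pmf.prob (uniform_draws m) {xs. ?P xs}
      \<le> (\<rho> ^ m * CARD('n) + e k) / w k"
    using e(2)
  proof eventually_elim
    case (elim k)
    define A where "A xs = mat 1 - (\<theta> / 2 ^ Suc k) *\<^sub>R sum_outer u xs" for xs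
    have A: "transpose (A xs) = A xs" for xs
      by (simp add: A_def transpose_diff transpose_scalar transpose_sum_outer)
    have pos: "0 < 1 - \<theta> * s / 2 ^ Suc k" using elim by (simp add: field_simps)
    then have wk: "0 < w k" by (simp add: w_def)
    have "measure_pmf.prob (uniform_draws m) {xs. ?P xs}
        \<le> measure_pmf.expectation (uniform_draws m) (\<lambda>xs. dyadic_trace_exp \<theta> k (sum_outer u xs)) / w k"
    proof (rule prob_uniform_draws_le[OF _ _ wk])
      fix xs
      have "trace (mat_pow (A xs) (2 ^ Suc k)) = (norm (mat_pow (A xs) (2 ^ k)))\<^sup>2"
        by (simp only: norm_transpose_square transpose_mat_pow A mat_pow_two_power_Suc)
      then show "0 \<le> dyadic_trace_exp \<theta> k (sum_outer u xs)"
        by (simp only: dyadic_trace_exp_def A_def) simp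
      assume "?P xs"
      then obtain v where v: "norm v = 1" "(\<Sum>p\<leftarrow>xs. (u p \<bullet> v)\<^sup>2) \<le> s" by blast
      have "v \<bullet> (A xs *v v) = 1 - \<theta> / 2 ^ Suc k * (\<Sum>p\<leftarrow>xs. (u p \<bullet> v)\<^sup>2)"
        using v(1) by (simp add: A_def matrix_vector_mult_diff_rdistrib inner_diff_right
            scaleR_matrix_vector_assoc[symmetric] quadratic_form_sum_outer norm_eq_1)
      also have "\<dots> \<ge> 1 - \<theta> / 2 ^ Suc k * s"
        by (intro diff_left_mono mult_left_mono v) (use \<theta> in simp)
      finally have ge: "1 - \<theta> * s / 2 ^ Suc k \<le> v \<bullet> (A xs *v v)" by simp
      then have "w k \<le> (v \<bullet> (A xs *v v)) ^ (2 ^ Suc k)"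
        unfolding w_def using pos by (intro power_mono) auto
      also have "\<dots> \<le> trace (mat_pow (A xs) (2 ^ Suc k))"
        using ge pos by (intro trace_power_ge[OF A v(1)]) linarith
      finally show "w k \<le> dyadic_trace_exp \<theta> k (sum_outer u xs)"
        by (simp only: dyadic_trace_exp_def A_def)
    qed
    also have "\<dots> \<le> (\<rho> ^ m * CARD('n) + e k) / w k"
      using elim wk by (intro divide_right_mono) auto
    finally show ?case .
  qed
  moreover have "(\<lambda>k. (\<rho> ^ m * CARD('n) + e k) / w k)
      \<longlonglongrightarrow> (\<rho> ^ m * CARD('n) + 0) / exp (- (\<theta> * s))"
    by (intro tendsto_divide tendsto_add tendsto_const e w) simp
  ultimately have "measure_pmf.prob (uniform_draws m) {xs. ?P xs}
      \<le> (\<rho> ^ m * CARD('n) + 0) / exp (- (\<theta> * s))"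
    by (intro tendsto_lowerbound[of _ _ sequentially]) auto
  then show ?thesis by (simp add: exp_minus field_simps)
qed

text \<open>The choice \<open>\<theta> * r = \<gamma>\<close> gives the exponents
  \<open>- (\<gamma> - \<gamma>^2 / 2) m / D\<close> from the trace and
  \<open>\<gamma> (1 - \<gamma>) m / D\<close> from the threshold. Their sum is
  \<open>- \<gamma>^2 m / (2 D)\<close>.\<close>

lemma matrix_Chernoff:
  fixes u :: "'b::finite \<Rightarrow> real^'n" and r D \<gamma> :: real and m :: nat
  assumes iso: "(\<Sum>p\<in>UNIV. outer (u p)) = mat 1"
    and r: "\<And>p. (norm (u p))\<^sup>2 \<le> r" and D: "r * CARD('b) = D" "1 \<le> D"
    and \<gamma>: "0 \<le> \<gamma>"
  shows "measure_pmf.prob (uniform_draws m)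
      {xs. \<exists>v. norm v = 1 \<and> (\<Sum>p\<leftarrow>xs. (u p \<bullet> v)\<^sup>2) \<le> (1 - \<gamma>) * m / CARD('b)}
    \<le> CARD('n) * exp (- (m * \<gamma>\<^sup>2 / (2 * D)))"
proof -
  define s where "s = (1 - \<gamma>) * m / CARD('b)"
  define \<theta> where "\<theta> = \<gamma> / r"
  define \<rho> where "\<rho> = 1 - (1 - exp (- \<theta> * r)) / (r * CARD('b))"
  have r0: "0 < r" using D by (metis less_le_trans zero_less_one zero_less_mult_pos2 of_nat_0_less_iff zero_less_card_finite)
  have \<theta>r: "\<theta> * r = \<gamma>" using r0 by (simp add: \<theta>_def)
  have \<rho>_eq: "\<rho> = 1 - (1 - exp (- \<gamma>)) / D"
    using \<theta>r D by (simp add: \<rho>_def)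
  have "1 - exp (- \<gamma>) \<le> D"
    using D(2) exp_gt_zero[of "- \<gamma>"] by linarith
  then have "(1 - exp (- \<gamma>)) / D \<le> 1"
    using D(2) by simp
  then have \<rho>0: "0 \<le> \<rho>" by (simp add: \<rho>_eq)
  have "exp (- \<gamma>) \<le> 1 - \<gamma> + \<gamma>\<^sup>2 / (2 * (1 + \<gamma> / 3))"
    using exp_le_quadratic[of "- \<gamma>"] \<gamma> by simp
  also have "\<dots> \<le> 1 - \<gamma> + \<gamma>\<^sup>2 / (2 * 1)"
    using \<gamma> by (intro add_left_mono divide_left_mono) auto
  finally have exp_bound: "exp (- \<gamma>) \<le> 1 - \<gamma> + \<gamma>\<^sup>2 / 2" by simp
  have "measure_pmf.prob (uniform_draws m)
      {xs. \<exists>v. norm v = 1 \<and> (\<Sum>p\<leftarrow>xs. (u p \<bullet> v)\<^sup>2) \<le> s} \<le> CARD('n) * \<rho> ^ m * exp (\<theta> * s)"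
    by (rule prob_small_quadratic_form_le[OF iso r r0 _ \<rho>_def \<rho>0]) (use \<gamma> r0 in \<open>simp add: \<theta>_def\<close>)
  also have "\<dots> \<le> CARD('n) * exp (- (\<gamma> - \<gamma>\<^sup>2 / 2) / D) ^ m * exp (\<theta> * s)"
  proof (intro mult_right_mono mult_left_mono power_mono \<rho>0)
    have "(\<gamma> - \<gamma>\<^sup>2 / 2) / D \<le> (1 - exp (- \<gamma>)) / D"
      using exp_bound D(2) by (intro divide_right_mono) auto
    then have "\<rho> \<le> 1 + - (\<gamma> - \<gamma>\<^sup>2 / 2) / D"
      unfolding \<rho>_eq minus_divide_left[symmetric] by linarith
    also have "\<dots> \<le> exp (- (\<gamma> - \<gamma>\<^sup>2 / 2) / D)" by (rule exp_ge_add_one_self)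
    finally show "\<rho> \<le> exp (- (\<gamma> - \<gamma>\<^sup>2 / 2) / D)" .
  qed auto
  also have "\<dots> = CARD('n) * exp (m * (- (\<gamma> - \<gamma>\<^sup>2 / 2) / D) + \<theta> * s)"
    by (simp only: exp_add exp_of_nat_mult mult.assoc)
  also have "m * (- (\<gamma> - \<gamma>\<^sup>2 / 2) / D) + \<theta> * s = - (m * \<gamma>\<^sup>2 / (2 * D))"
  proof -
    have "\<theta> * s = \<gamma> * (1 - \<gamma>) * m / D"
      using r0 by (simp add: \<theta>_def s_def D(1)[symmetric])
    show ?thesis
      unfolding \<open>\<theta> * s = _\<close> using D(2) by (simp add: field_simps power2_eq_square)
  qed
  finally show ?thesis by (simp add: s_def)
qed

section \<open>The tensor product and its matrix\<close>

lemma matrix_inv_inverse: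
  fixes A :: "real^'n^'n"
  assumes "invertible A"
  shows "A ** matrix_inv A = mat 1" "matrix_inv A ** A = mat 1"
  using someI_ex[OF assms[unfolded invertible_def]] unfolding matrix_inv_def by blast+

lemma tube_L_tube_Linv: "invertible M \<Longrightarrow> tube_L M (tube_Linv M a) = a"
  by (simp add: tube_L_def tube_Linv_def matrix_vector_mul_assoc matrix_inv_inverse)

lemma tube_Linv_tube_L: "invertible M \<Longrightarrow> tube_Linv M (tube_L M a) = a"
  by (simp add: tube_L_def tube_Linv_def matrix_vector_mul_assoc matrix_inv_inverse)

lemma tube_L_sum: "tube_L M (\<Sum>s\<in>A. f s) = (\<Sum>s\<in>A. tube_L M (f s))"
  unfolding tube_L_def by (rule linear_sum[OF matrix_vector_mul_linear])

text \<open>In the transform domain tubes multiply entrywise, so every frontal slice obeys ordinary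
  matrix multiplication.\<close>

lemma tensor_L_prod:
  assumes "invertible M"
  shows "tensor_L M (tensor_prod M A B) $ i $ j $ k
    = (\<Sum>s\<in>UNIV. tensor_L M A $ i $ s $ k * tensor_L M B $ s $ j $ k)"
  by (simp add: tensor_L_def tensor_prod_def tube_L_sum tube_prod_def tube_L_tube_Linv assms)

lemma tensor_L_transpose:
  assumes "invertible M"
  shows "tensor_L M (tensor_transpose M A) $ i $ j $ k = tensor_L M A $ j $ i $ k"
  by (simp add: tensor_L_def tensor_transpose_def tensor_Linv_def tube_L_tube_Linv assms
      transpose_def frontal_slice_def)

lemma tensor_L_id:
  assumes "invertible M"
  shows "tensor_L M (tensor_id M) $ i $ j $ k = (if i = j then 1 else 0)"
  by (simp add: tensor_L_def tensor_id_def tube_L_tube_Linv assms) (simp add: tube_L_def)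

text \<open>Invertibility of \<open>M\<close> makes the transform injective, so identities for the
  tensor product can be checked slice by slice as matrix identities.\<close>

lemma tensor_eqI:
  assumes "invertible M" "\<And>i j k. tensor_L M A $ i $ j $ k = tensor_L M B $ i $ j $ k"
  shows "A = B"
proof -
  have "tube_L M (A $ i $ j) = tube_L M (B $ i $ j)" for i j
    using assms(2)[of i j] by (simp add: tensor_L_def vec_eq_iff)
  then have "A $ i $ j = B $ i $ j" for i j
    by (metis tube_Linv_tube_L[OF assms(1)])
  then show ?thesis by (simp add: vec_eq_iff)
qed

lemma tensor_prod_assoc:
  assumes "invertible M"
  shows "tensor_prod M (tensor_prod M A B) C = tensor_prod M A (tensor_prod M B C)"
proof (rule tensor_eqI[OF assms])
  fix i j k
  show "tensor_L M (tensor_prod M (tensor_prod M A B) C) $ i $ j $ k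
      = tensor_L M (tensor_prod M A (tensor_prod M B C)) $ i $ j $ k"
    unfolding tensor_L_prod[OF assms] sum_distrib_left sum_distrib_right
    by (subst sum.swap) (simp add: mult.assoc)
qed

lemma tensor_prod_id_left:
  assumes "invertible M"
  shows "tensor_prod M (tensor_id M) A = A"
  by (rule tensor_eqI[OF assms])
    (simp add: tensor_L_prod[OF assms] tensor_L_id[OF assms] if_distrib[of "\<lambda>x. x * _"] cong: if_cong)

lemma tensor_prod_id_right:
  assumes "invertible M"
  shows "tensor_prod M A (tensor_id M) = A"
  by (rule tensor_eqI[OF assms])
    (simp add: tensor_L_prod[OF assms] tensor_L_id[OF assms] if_distrib[of "\<lambda>x. _ * x"] cong: if_cong)

lemma tensor_prod_add_right: "tensor_prod M A (B + C) = tensor_prod M A B + tensor_prod M A C"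
  by (simp add: tensor_prod_def vec_eq_iff linear_add[OF linear_tube_prod] sum.distrib)

lemma tensor_inv_id:
  assumes "invertible M"
  shows "tensor_inv M (tensor_id M) = tensor_id M"
  unfolding tensor_inv_def
  by (rule the_equality) (simp_all add: tensor_prod_id_left tensor_prod_id_right assms)

lemma tensor_column_space_prod:
  assumes "X \<in> tensor_column_space M U"
  obtains C where "X = tensor_prod M U C"
proof -
  obtain c :: "'c \<Rightarrow> real^'a^1^1" where c: "X = (\<Sum>j\<in>UNIV. tensor_prod M (tensor_column U j) (c j))"
    using assms by (auto simp: tensor_column_space_def)
  \<comment> \<open>The coefficient tubes are stacked into a single lateral slice.\<close>
  have "X = tensor_prod M U (\<chi> j s. c j $ 1 $ 1)"
    by (simp add: c vec_eq_iff tensor_prod_def tensor_column_def forall_1 UNIV_1)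
  then show thesis by (rule that)
qed

text \<open>The inner inverse in the projection is that of the identity. The transpose of
  \<open>U\<close> recovers the coefficients of \<open>X\<close> and annihilates \<open>Y\<close>,
  so the projection of \<open>T\<close> is \<open>X\<close>.\<close>

lemma tensor_proj_residual:
  assumes M: "invertible M" and U: "tensor_prod M (tensor_transpose M U) U = tensor_id M"
    and T: "T = X + Y" "X \<in> tensor_column_space M U" "Y \<in> tensor_orth_space M U"
  shows "T - tensor_prod M (tensor_proj M U) T = Y"
proof -
  obtain C where C: "X = tensor_prod M U C" using T(2) by (rule tensor_column_space_prod)
  have "tensor_prod M (tensor_transpose M U) X = C"
    unfolding C by (simp add: tensor_prod_assoc[OF M, symmetric] U tensor_prod_id_left[OF M])
  moreover have "tensor_prod M (tensor_transpose M U) Y = 0"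
    using T(3) by (simp add: tensor_orth_space_def)
  ultimately have "tensor_prod M (tensor_transpose M U) T = C"
    by (simp add: T(1) tensor_prod_add_right)
  then have "tensor_prod M (tensor_proj M U) T = X"
    by (simp add: tensor_proj_def U tensor_inv_id[OF M] tensor_prod_id_right[OF M]
        tensor_prod_assoc[OF M] C)
  then show ?thesis by (simp add: T(1))
qed

section \<open>Isometry of the matrix of an orthonormal tensor\<close>

lemma norm_vec_square: "(norm (v :: ('b::real_normed_vector)^'n))\<^sup>2 = (\<Sum>i\<in>UNIV. (norm (v $ i))\<^sup>2)"
  by (simp add: norm_vec_def L2_set_def sum_nonneg)

lemma norm_tensor_square:
  "(norm (A :: real^'k^'b^'a))\<^sup>2 = (\<Sum>i\<in>UNIV. \<Sum>j\<in>UNIV. (norm (A $ i $ j))\<^sup>2)"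
  unfolding norm_vec_square[of A] norm_vec_square[of "A $ _"] ..

lemma norm_unfold: "norm (unfold T) = norm T"
proof -
  have "(norm (unfold T))\<^sup>2 = (\<Sum>p\<in>UNIV \<times> UNIV. (T $ fst p $ 1 $ snd p)\<^sup>2)"
    by (simp add: norm_vec_square unfold_def)
  also have "\<dots> = (\<Sum>i\<in>UNIV. \<Sum>k\<in>UNIV. (T $ i $ 1 $ k)\<^sup>2)"
    by (simp only: sum.cartesian_product case_prod_unfold)
  also have "\<dots> = (norm T)\<^sup>2"
    by (simp add: norm_tensor_square UNIV_1 norm_vec_square[of "_ $ _ $ _"])
  finally show ?thesis by simp
qed

lemma norm_tensor_L:
  assumes "\<And>a. norm (tube_L M a) = c * norm a"
  shows "(norm (tensor_L M A))\<^sup>2 = c\<^sup>2 * (norm A)\<^sup>2"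
  by (simp add: norm_tensor_square tensor_L_def assms power_mult_distrib sum_distrib_left)

text \<open>Each frontal slice of the transformed \<open>U\<close> has orthonormal columns, and the
  factor \<open>c\<close> by which the transform scales norms cancels.\<close>

lemma norm_tensor_prod_orthonormal:
  fixes U :: "real^'k^'b^'a" and C :: "real^'k^1^'b"
  assumes M: "invertible M" and c: "0 < c" "\<And>a. norm (tube_L M a) = c * norm a"
    and U: "tensor_prod M (tensor_transpose M U) U = tensor_id M"
  shows "norm (tensor_prod M U C) = norm C"
proof -
  let ?U = "tensor_L M U" and ?C = "tensor_L M C"
  have orth: "(\<Sum>i\<in>UNIV. ?U $ i $ s $ k * ?U $ i $ t $ k) = (if s = t then 1 else 0)" for s t k
    using tensor_L_prod[OF M, of "tensor_transpose M U" U s t k]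
    by (simp add: U tensor_L_id[OF M] tensor_L_transpose[OF M])
  have entry_norm: "(norm (tensor_L M A))\<^sup>2 = (\<Sum>k\<in>UNIV. \<Sum>i\<in>UNIV. (tensor_L M A $ i $ 1 $ k)\<^sup>2)"
    for A :: "real^'k^1^'d"
    by (subst sum.swap) (simp add: norm_tensor_square UNIV_1 norm_vec_square[of "_ $ _ $ _"])
  have slice: "(\<Sum>i\<in>UNIV. (tensor_L M (tensor_prod M U C) $ i $ 1 $ k)\<^sup>2)
      = (\<Sum>s\<in>UNIV. (?C $ s $ 1 $ k)\<^sup>2)" for k
  proof -
    have "(\<Sum>i\<in>UNIV. (tensor_L M (tensor_prod M U C) $ i $ 1 $ k)\<^sup>2)
        = (\<Sum>i\<in>UNIV. \<Sum>s\<in>UNIV. \<Sum>t\<in>UNIV.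
            ?C $ s $ 1 $ k * (?C $ t $ 1 $ k * (?U $ i $ s $ k * ?U $ i $ t $ k)))"
      unfolding tensor_L_prod[OF M] power2_eq_square sum_product by (simp add: mult_ac)
    also have "\<dots> = (\<Sum>s\<in>UNIV. \<Sum>i\<in>UNIV. \<Sum>t\<in>UNIV.
            ?C $ s $ 1 $ k * (?C $ t $ 1 $ k * (?U $ i $ s $ k * ?U $ i $ t $ k)))"
      by (rule sum.swap)
    also have "\<dots> = (\<Sum>s\<in>UNIV. \<Sum>t\<in>UNIV. \<Sum>i\<in>UNIV.
            ?C $ s $ 1 $ k * (?C $ t $ 1 $ k * (?U $ i $ s $ k * ?U $ i $ t $ k)))"
      by (intro sum.cong refl sum.swap)
    also have "\<dots> = (\<Sum>s\<in>UNIV. (?C $ s $ 1 $ k)\<^sup>2)"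
      unfolding sum_distrib_left[symmetric] orth
      by (simp add: if_distrib[of "\<lambda>x. _ * x"] power2_eq_square cong: if_cong)
    finally show ?thesis .
  qed
  have "c\<^sup>2 * (norm (tensor_prod M U C))\<^sup>2 = c\<^sup>2 * (norm C)\<^sup>2"
    unfolding norm_tensor_L[OF c(2), symmetric] entry_norm slice ..
  then show ?thesis using c(1) by simp
qed

lemma gram_nth: "gram A $ a $ b = column a A \<bullet> column b A"
  by (simp add: gram_def matrix_matrix_mult_def transpose_def column_def inner_vec_def)

text \<open>Unfolding carries the isometry over to the matrix. Polarization turns it into
  preservation of inner products, which is then read off on basis vectors.\<close>

lemma gram_lmat:
  assumes M: "invertible M" and c: "0 < c" "\<And>a. norm (tube_L M a) = c * norm a"
    and U: "tensor_prod M (tensor_transpose M U) U = tensor_id M"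
  shows "gram (lmat M U) = mat 1"
proof -
  have norm: "norm (lmat M U *v v) = norm v" for v
  proof -
    obtain C where C: "unfold C = v" using unfold_surj by blast
    show ?thesis
      unfolding C[symmetric] lmat[symmetric] norm_unfold
      by (rule norm_tensor_prod_orthonormal[OF M c U])
  qed
  have "(lmat M U *v v) \<bullet> (lmat M U *v w) = v \<bullet> w" for v w
    unfolding dot_norm matrix_vector_right_distrib[symmetric] norm ..
  from this[of "axis _ 1" "axis _ 1"] show ?thesis
    by (simp add: vec_eq_iff gram_nth matrix_vector_mult_basis mat_def inner_axis_axis)
qed

section \<open>Orthogonal projections and coherence in vector form\<close>

lemma orth_proj_eqI:
  assumes S: "subspace S" and x: "x \<in> S" "v - x \<in> orthogonal_comp S"
  shows "orth_proj S v = x"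
  unfolding orth_proj_def
proof (rule the_equality)
  show "x \<in> S \<and> v - x \<in> orthogonal_comp S" using x by simp
  fix z assume z: "z \<in> S \<and> v - z \<in> orthogonal_comp S"
  have "x - z \<in> S" using S x z by (simp add: subspace_diff)
  moreover have "(v - z) - (v - x) \<in> orthogonal_comp S"
    by (rule subspace_diff[OF subspace_orthogonal_comp]) (use x z in auto)
  ultimately have "orthogonal (x - z) (x - z)" by (simp add: orthogonal_comp_def)
  then show "z = x" by (simp add: orthogonal_self)
qed

text \<open>The difference \<open>unfold Y - y = x - unfold X\<close> lies in \<open>S\<close>. This
  links the tensor and the vector decomposition of \<open>T\<close>: the cosine of the principal
  angle becomes the quotient of the norms of \<open>y\<close> and \<open>Y\<close>.\<close>

lemma orth_proj_unfold_orth_space: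
  assumes S: "S = span (columns (lmat M U))"
    and T: "T = X + Y" "X \<in> tensor_column_space M U"
    and t: "unfold T = x + y" "x \<in> S" "y \<in> orthogonal_comp S"
  shows "orth_proj (orthogonal_comp S) (unfold Y) = y"
proof (rule orth_proj_eqI[OF subspace_orthogonal_comp t(3)])
  obtain C where "X = tensor_prod M U C" using T(2) by (rule tensor_column_space_prod)
  then have "unfold X \<in> S"
    by (simp add: S lmat matrix_vector_mult_in_columnspace)
  then have "x - unfold X \<in> S" using t(2) by (simp add: S span_diff)
  moreover have "unfold Y - y = x - unfold X"
  proof -
    have "unfold T = unfold X + unfold Y" by (simp add: T(1) vec_eq_iff unfold_def)
    then show ?thesis using t(1) by (simp add: algebra_simps)
  qed
  ultimately show "unfold Y - y \<in> orthogonal_comp (orthogonal_comp S)"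
    using orthogonal_comp_subset by auto
qed

lemma span_columns_eq_range: "span (columns A) = range (\<lambda>v. A *v v)" for A :: "real^'q^'p"
proof
  have "columns A \<subseteq> range (\<lambda>v. A *v v)"
    by (auto simp: columns_def matrix_vector_mult_basis[symmetric])
  moreover have "subspace (range (\<lambda>v. A *v v))"
    by (rule linear_subspace_image[OF matrix_vector_mul_linear subspace_UNIV])
  ultimately show "span (columns A) \<subseteq> range (\<lambda>v. A *v v)" by (rule span_minimal)
qed (auto intro: matrix_vector_mult_in_columnspace)

lemma orthogonal_comp_columns:
  fixes A :: "real^'q^'p"
  assumes "y \<in> orthogonal_comp (span (columns A))"
  shows "(\<Sum>p\<in>UNIV. y $ p *\<^sub>R A $ p) = 0"
proof -
  have "(\<Sum>p\<in>UNIV. A $ p $ a * y $ p) = 0" for a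
  proof -
    have "column a A \<in> span (columns A)" by (auto intro!: span_base simp: columns_def)
    with assms have "column a A \<bullet> y = 0" by (simp add: orthogonal_comp_def orthogonal_def)
    then show ?thesis by (simp add: inner_vec_def column_def)
  qed
  then show ?thesis by (simp add: vec_eq_iff mult.commute)
qed

text \<open>The projection of a basis vector is \<open>A\<close> applied to the corresponding row of
  \<open>A\<close>, and \<open>A\<close> is an isometry. Coherence therefore measures the largest
  row norm.\<close>

lemma norm_orth_proj_axis:
  fixes A :: "real^'q^'p"
  assumes A: "gram A = mat 1"
  shows "(norm (orth_proj (span (columns A)) (axis p 1)))\<^sup>2 = (norm (A $ p))\<^sup>2"
proof -
  have T: "transpose A *v axis p 1 = A $ p"
    unfolding matrix_vector_mult_basis by (simp add: column_def transpose_def vec_eq_iff)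
  have inner: "(A *v v) \<bullet> (A *v w) = v \<bullet> w" for v w
  proof -
    have "(A *v v) \<bullet> (A *v w) = v \<bullet> (transpose A *v (A *v w))"
      using dot_lmul_matrix[of "A *v w" A v] by (simp add: inner_commute)
    then show ?thesis
      using A by (simp add: gram_def matrix_vector_mul_assoc del: transpose_matrix_vector)
  qed
  have "axis p 1 - A *v (A $ p) \<in> orthogonal_comp (span (columns A))"
  proof -
    have "(A *v v) \<bullet> axis p 1 = v \<bullet> (A $ p)" for v
      using dot_lmul_matrix[of "axis p 1" A v] T by (simp add: inner_commute)
    then show ?thesis
      by (auto simp: orthogonal_comp_def orthogonal_def span_columns_eq_range inner_diff_right inner)
  qed
  then have "orth_proj (span (columns A)) (axis p 1) = A *v (A $ p)"
    by (intro orth_proj_eqI subspace_span matrix_vector_mult_in_columnspace)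
  then show ?thesis by (simp add: power2_norm_eq_inner inner)
qed

lemma sum_outer_rows:
  fixes A :: "real^'q^'p"
  assumes "gram A = mat 1"
  shows "(\<Sum>p\<in>UNIV. outer (A $ p)) = mat 1"
proof -
  have "(\<Sum>p\<in>UNIV. outer (A $ p)) = gram A"
    by (simp add: vec_eq_iff outer_def gram_def matrix_matrix_mult_def transpose_def)
  then show ?thesis by (simp add: assms)
qed

text \<open>The product of \<open>n2\<close>, \<open>n3\<close> and the coherence equals
  \<open>CARD('p)\<close> times the largest squared row norm. The second bound follows because the
  squared row norms add up to the trace of the identity; it later ensures
  \<open>D \<ge> 1\<close>.\<close>

lemma coherence_properties:
  fixes A :: "real^'q^'p"
  assumes A: "gram A = mat 1" and n: "0 < n1" "n2 * n3 = CARD('q)" "n1 * n3 = CARD('p)"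
  shows "(norm (A $ p))\<^sup>2 \<le> real n2 * real n3 * coherence n1 n2 (span (columns A)) / CARD('p)"
    and "real CARD('q) \<le> real n2 * real n3 * coherence n1 n2 (span (columns A))"
proof -
  define r where "r = Max (range (\<lambda>p. (norm (A $ p))\<^sup>2))"
  have row: "(norm (A $ p))\<^sup>2 \<le> r" for p by (simp add: r_def)
  have pos: "0 < n2" using n(2) by (metis mult_0 zero_less_card_finite gr0I less_irrefl)
  have "real n2 * real n3 * coherence n1 n2 (span (columns A)) = real (n1 * n3) * r"
    using pos by (simp add: coherence_def norm_orth_proj_axis[OF A] r_def)
  then have D: "real n2 * real n3 * coherence n1 n2 (span (columns A)) = CARD('p) * r"
    by (simp only: n)
  show "(norm (A $ p))\<^sup>2 \<le> real n2 * real n3 * coherence n1 n2 (span (columns A)) / CARD('p)"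
    using row[of p] by (simp add: D)
  have "real CARD('q) = trace (\<Sum>p\<in>UNIV. outer (A $ p))"
    by (simp add: sum_outer_rows[OF A] trace_I)
  also have "\<dots> = (\<Sum>p\<in>UNIV. (norm (A $ p))\<^sup>2)"
    using trace_mult_outer[of "mat 1 :: real^'q^'q"] by (simp add: trace_sum power2_norm_eq_inner)
  also have "\<dots> \<le> CARD('p) * r"
    using sum_mono[of UNIV "\<lambda>p. (norm (A $ p))\<^sup>2" "\<lambda>_. r"] row by simp
  finally show "real CARD('q) \<le> real n2 * real n3 * coherence n1 n2 (span (columns A))"
    by (simp add: D)
qed

section \<open>Least squares residual and weighted sampling\<close>

lemma gram_quadratic_form: "v \<bullet> (gram A *v v) = (norm (A *v v))\<^sup>2" for A :: "real^'q^'p"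
proof -
  have "v \<bullet> (gram A *v v) = v \<bullet> (transpose A *v (A *v v))"
    by (simp add: gram_def matrix_vector_mul_assoc del: transpose_matrix_vector)
  also have "\<dots> = (A *v v) \<bullet> (A *v v)"
    using dot_lmul_matrix[of "A *v v" A v] by (simp add: inner_commute)
  finally show ?thesis by (simp add: power2_norm_eq_inner)
qed

lemma invertible_gram:
  fixes A :: "real^'q^'p"
  assumes "\<And>v. v \<noteq> 0 \<Longrightarrow> 0 < v \<bullet> (gram A *v v)"
  shows "invertible (gram A)"
  unfolding invertible_left_inverse matrix_left_invertible_ker
proof (intro allI impI)
  fix v assume "gram A *v v = 0"
  then show "v = 0" using assms[of v] by auto
qed

text \<open>The projection fixes the range of \<open>A\<close>, so only \<open>z\<close> matters. If
  \<open>h\<close> solves the normal equations \<open>gram A *v h = g\<close>, the residual is the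
  squared norm of \<open>z\<close> minus \<open>g \<bullet> h\<close>, which is the squared norm of
  \<open>A *v h\<close>. A lower bound \<open>\<kappa>\<close> on the quadratic form bounds the norm
  of \<open>h\<close> by that of \<open>g\<close> over \<open>\<kappa>\<close>.\<close>

lemma column_proj_residual:
  fixes A :: "real^'q^'p" and a :: "real^'q" and z :: "real^'p" and \<kappa> :: real
  assumes inv: "invertible (gram A)"
  defines "res \<equiv> (norm ((A *v a + z) - column_proj A *v (A *v a + z)))\<^sup>2"
  shows "res \<le> (norm z)\<^sup>2"
    and "\<lbrakk>0 < \<kappa>; \<And>v. \<kappa> * (norm v)\<^sup>2 \<le> v \<bullet> (gram A *v v)\<rbrakk>
      \<Longrightarrow> (norm z)\<^sup>2 - (norm (transpose A *v z))\<^sup>2 / \<kappa> \<le> res"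
proof -
  define g where "g = transpose A *v z"
  define h where "h = matrix_inv (gram A) *v g"
  have "column_proj A *v (A *v a) = A *v ((matrix_inv (gram A) ** gram A) *v a)"
    by (simp only: column_proj_def gram_def matrix_vector_mul_assoc matrix_mul_assoc)
  then have "column_proj A *v (A *v a) = A *v a"
    by (simp add: matrix_inv_inverse[OF inv])
  moreover have "column_proj A *v z = A *v h"
    by (simp only: column_proj_def h_def g_def matrix_vector_mul_assoc matrix_mul_assoc)
  ultimately have res: "res = (norm (z - A *v h))\<^sup>2"
    by (simp add: res_def matrix_vector_right_distrib)
  have Gh: "gram A *v h = g"
    by (simp add: h_def matrix_vector_mul_assoc matrix_inv_inverse[OF inv])
  have zAh: "z \<bullet> (A *v h) = g \<bullet> h"
    using dot_lmul_matrix[of z A h] by (simp add: g_def)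
  have hg: "g \<bullet> h = (norm (A *v h))\<^sup>2"
    using gram_quadratic_form[of h A] by (simp add: Gh inner_commute)
  have eq: "res = (norm z)\<^sup>2 - g \<bullet> h"
  proof -
    have "(norm (z - A *v h))\<^sup>2 = (norm z)\<^sup>2 - 2 * (z \<bullet> (A *v h)) + (norm (A *v h))\<^sup>2"
      by (simp add: power2_norm_eq_inner inner_diff_left inner_diff_right inner_commute)
    then show ?thesis by (simp add: res zAh hg)
  qed
  show "res \<le> (norm z)\<^sup>2" by (simp add: eq hg)
  assume \<kappa>: "0 < \<kappa>" "\<And>v. \<kappa> * (norm v)\<^sup>2 \<le> v \<bullet> (gram A *v v)"
  have gh_le: "g \<bullet> h \<le> norm g * norm h" by (rule norm_cauchy_schwarz)
  have "\<kappa> * (norm h * norm h) \<le> norm g * norm h"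
    using \<kappa>(2)[of h] gh_le by (simp add: Gh inner_commute power2_eq_square)
  then have "norm h \<le> norm g / \<kappa>"
    using \<kappa>(1) by (cases "h = 0") (simp_all add: field_simps)
  then have "norm g * norm h \<le> norm g * (norm g / \<kappa>)" by (intro mult_left_mono) auto
  with gh_le have "g \<bullet> h \<le> (norm g)\<^sup>2 / \<kappa>" by (simp add: power2_eq_square)
  then show "(norm z)\<^sup>2 - (norm (transpose A *v z))\<^sup>2 / \<kappa> \<le> res"
    by (simp add: eq g_def del: transpose_matrix_vector)
qed

text \<open>The vector form of \<open>sample_tensor\<close>, so that \<open>x\<close> and
  \<open>y\<close> can be sampled separately. The case distinction disappears because the weight of
  an undrawn position is already zero.\<close>

definition sample_vec :: "'p multiset \<Rightarrow> real^'p \<Rightarrow> real^'p" where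
  "sample_vec \<Omega> z = (\<chi> p. sqrt (count \<Omega> p) * z $ p)"

lemma unfold_sample_tensor: "unfold (sample_tensor \<Omega> T) = sample_vec \<Omega> (unfold T)"
  by (simp add: sample_vec_def unfold_def sample_tensor_def vec_eq_iff not_in_iff)

lemma sample_vec_add: "sample_vec \<Omega> (x + y) = sample_vec \<Omega> x + sample_vec \<Omega> y"
  by (simp add: sample_vec_def vec_eq_iff algebra_simps)

lemma sample_vec_mult: "sample_vec \<Omega> (A *v a) = sample_rows \<Omega> A *v a"
  by (simp add: sample_vec_def sample_rows_def vec_eq_iff matrix_vector_mul_component not_in_iff)

lemma norm_sample_vec: "(norm (sample_vec \<Omega> z))\<^sup>2 = (\<Sum>p\<in>#\<Omega>. (z $ p)\<^sup>2)"
  by (simp add: norm_vec_square sample_vec_def power_mult_distrib sum_count_eq)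

lemma gram_sample_rows_form:
  "v \<bullet> (gram (sample_rows \<Omega> A) *v v) = (\<Sum>p\<in>#\<Omega>. (A $ p \<bullet> v)\<^sup>2)" for A :: "real^'q^'p"
  by (simp add: gram_quadratic_form sample_vec_mult[symmetric] norm_sample_vec
      matrix_vector_mul_component)

lemma transpose_sample_rows_mult:
  "transpose (sample_rows \<Omega> A) *v sample_vec \<Omega> z = (\<Sum>p\<in>#\<Omega>. z $ p *\<^sub>R A $ p)"
  for A :: "real^'q^'p"
proof -
  have "(transpose (sample_rows \<Omega> A) *v sample_vec \<Omega> z) $ a = (\<Sum>p\<in>#\<Omega>. z $ p *\<^sub>R A $ p) $ a" for a
  proof -
    have "(transpose (sample_rows \<Omega> A) *v sample_vec \<Omega> z) $ a
        = (\<Sum>p\<in>UNIV. real (count \<Omega> p) * (z $ p * A $ p $ a))"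
      unfolding matrix_vector_mult_def transpose_def vec_lambda_beta
      by (rule sum.cong) (auto simp: sample_rows_def sample_vec_def not_in_iff)
    also have "\<dots> = (\<Sum>p\<in>#\<Omega>. z $ p * A $ p $ a)" by (rule sum_count_eq)
    also have "\<dots> = (\<Sum>p\<in>#\<Omega>. z $ p *\<^sub>R A $ p) $ a" by (induction \<Omega>) simp_all
    finally show ?thesis .
  qed
  then show ?thesis by (simp add: vec_eq_iff)
qed

section \<open>The sampled residual\<close>

text \<open>Here \<open>\<nu>\<close> is the mean square and \<open>K + 1\<close> bounds the ratio
  of the squares to it. Both tails use the variance bound \<open>K * \<nu>^2\<close>. Upward
  deviations are at most \<open>K * \<nu>\<close>, but downward ones can be as large as
  \<open>\<nu>\<close>, whence \<open>K + 1\<close> in the lower tail.\<close>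

lemma square_sample_tails:
  fixes y :: "'b::finite \<Rightarrow> real" and \<nu> K L :: real and m :: nat
  assumes \<nu>: "(\<Sum>p\<in>UNIV. (y p)\<^sup>2) = CARD('b) * \<nu>" "0 < \<nu>"
    and y: "\<And>p. (y p)\<^sup>2 \<le> (K + 1) * \<nu>" and K: "0 \<le> K" and m: "0 < m" and L: "0 \<le> L"
  defines "Z \<equiv> \<lambda>p. (y p)\<^sup>2 - \<nu>"
  shows "measure_pmf.prob (uniform_draws m)
      {xs. \<nu> * (sqrt (2 * L * m * K) + 2 * L / 3 * K) < sum_list (map Z xs)} \<le> exp (- L)"
    and "measure_pmf.prob (uniform_draws m)
      {xs. sum_list (map Z xs) < - (\<nu> * (sqrt (2 * L * m * K) + 2 * L / 3 * (K + 1)))} \<le> exp (- L)"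
proof -
  have mean: "(\<Sum>p\<in>UNIV. Z p) = 0" by (simp add: Z_def sum_subtractf \<nu>)
  have minus: "sum_list (map (\<lambda>p. - Z p) xs) = - sum_list (map Z xs)" for xs
    by (induction xs) simp_all
  \<comment> \<open>One factor of the fourth power is replaced by its bound
    \<open>(K + 1) * \<nu>\<close>; what remains is linear in the squares, whose sum is
    known.\<close>
  have "(\<Sum>p\<in>UNIV. (Z p)\<^sup>2) \<le> (\<Sum>p\<in>UNIV. K * \<nu> * (y p)\<^sup>2 - \<nu> * (y p)\<^sup>2 + \<nu>\<^sup>2)"
  proof (rule sum_mono)
    fix p
    have "(y p)\<^sup>2 * (y p)\<^sup>2 \<le> (K + 1) * \<nu> * (y p)\<^sup>2" by (intro mult_right_mono y) simp
    then show "(Z p)\<^sup>2 \<le> K * \<nu> * (y p)\<^sup>2 - \<nu> * (y p)\<^sup>2 + \<nu>\<^sup>2"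
      by (simp add: Z_def power2_eq_square algebra_simps)
  qed
  also have "\<dots> = CARD('b) * (K * \<nu>\<^sup>2)"
    unfolding sum.distrib sum_subtractf sum_distrib_left[symmetric] \<nu>(1)
    by (simp add: power2_eq_square)
  finally have var: "(\<Sum>p\<in>UNIV. (Z p)\<^sup>2) / CARD('b) \<le> K * \<nu>\<^sup>2"
    by (simp add: field_simps)
  have sqrt: "sqrt (2 * L * m * (K * \<nu>\<^sup>2)) = \<nu> * sqrt (2 * L * m * K)"
    using \<nu>(2) by (simp add: real_sqrt_mult)
  show "measure_pmf.prob (uniform_draws m)
      {xs. \<nu> * (sqrt (2 * L * m * K) + 2 * L / 3 * K) < sum_list (map Z xs)} \<le> exp (- L)"
    (is "?p1 \<le> _")
  proof (cases "K = 0")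
    \<comment> \<open>\<open>Bernstein\<close> asks for a positive variance bound. For
      \<open>K = 0\<close> no square exceeds the mean, so no upward deviation occurs.\<close>
    case True
    then have "Z p \<le> 0" for p using y[of p] by (simp add: Z_def)
    then have "sum_list (map Z xs) \<le> 0" for xs by (induction xs) (simp_all add: add_nonpos_nonpos)
    then have "{xs. 0 < sum_list (map Z xs)} = {}" by (auto simp: not_less)
    then show ?thesis by (simp add: True)
  next
    case False
    have "?p1 \<le> measure_pmf.prob (uniform_draws m)
        {xs. sqrt (2 * L * m * (K * \<nu>\<^sup>2)) + 2 * (K * \<nu>) * L / 3 \<le> sum_list (map Z xs)}"
      unfolding sqrt by (intro measure_pmf.finite_measure_mono) (auto simp: algebra_simps)
    also have "\<dots> \<le> exp (- L)"
      by (rule Bernstein[OF mean _ var])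
        (use y K m L False \<nu>(2) in \<open>auto simp: Z_def algebra_simps\<close>)
    finally show ?thesis .
  qed
  show "measure_pmf.prob (uniform_draws m)
      {xs. sum_list (map Z xs) < - (\<nu> * (sqrt (2 * L * m * K) + 2 * L / 3 * (K + 1)))} \<le> exp (- L)"
    (is "?p2 \<le> _")
  proof (cases "K = 0")
    \<comment> \<open>For \<open>K = 0\<close> the deviations \<open>- Z p\<close> are nonnegative
      with sum zero, hence all vanish.\<close>
    case True
    have "\<forall>p\<in>UNIV. - Z p = 0"
      using mean True y
      by (subst sum_nonneg_eq_0_iff[symmetric]) (auto simp: sum_negf, simp add: Z_def)
    then have "sum_list (map Z xs) = 0" for xs by (induction xs) simp_all
    then have "{xs. sum_list (map Z xs) < - (\<nu> * (sqrt (2 * L * m * K) + 2 * L / 3 * (K + 1)))} = {}"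
      using True \<nu>(2) L by (auto simp: not_less)
    then show ?thesis by simp
  next
    case False
    have "?p2 \<le> measure_pmf.prob (uniform_draws m)
        {xs. sqrt (2 * L * m * (K * \<nu>\<^sup>2)) + 2 * ((K + 1) * \<nu>) * L / 3 \<le> sum_list (map (\<lambda>p. - Z p) xs)}"
      unfolding sqrt minus by (intro measure_pmf.finite_measure_mono) (auto simp: algebra_simps)
    also have "\<dots> \<le> exp (- L)"
    proof (rule Bernstein)
      show "- Z p \<le> (K + 1) * \<nu>" for p
        using K \<nu>(2) by (simp add: Z_def algebra_simps)
    qed (use mean var False K m L \<nu>(2) in \<open>auto simp: sum_negf\<close>)
    finally show ?thesis .
  qed
qed

text \<open>\<open>Pinelis\<close> with variance bound \<open>r * \<nu>\<close> and summands of
  squared norm at most \<open>(K + 1) * r * \<nu>\<close>. The sample size hypothesis amounts to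
  \<open>l * b \<le> 1\<close>, so the Bernstein correction costs only the factor
  \<open>3 / 2\<close>.\<close>

lemma weighted_row_sample_tail:
  fixes y :: "'b::finite \<Rightarrow> real" and W :: "'b \<Rightarrow> real^'n" and \<nu> K L r :: real and m :: nat
  assumes \<nu>: "(\<Sum>p\<in>UNIV. (y p)\<^sup>2) = CARD('b) * \<nu>" "0 < \<nu>"
    and y: "\<And>p. (y p)\<^sup>2 \<le> (K + 1) * \<nu>"
    and W: "\<And>p. (norm (W p))\<^sup>2 \<le> r" "0 < r" and orth: "(\<Sum>p\<in>UNIV. y p *\<^sub>R W p) = 0"
    and K: "0 \<le> K" and L: "1 \<le> L" and m: "(K + 1) * L \<le> m"
  shows "measure_pmf.prob (uniform_draws m)
      {xs. sqrt (r * \<nu> * m) * (1 + 9 / 5 * sqrt L) \<le> norm (sum_list (map (\<lambda>p. y p *\<^sub>R W p) xs))}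
    \<le> exp (- L)"
proof -
  define v where "v = r * \<nu>"
  define b where "b = sqrt ((K + 1) * v)"
  \<comment> \<open>Chosen so that \<open>m * v * l^2 = L\<close>.\<close>
  define l where "l = sqrt L / sqrt (v * m)"
  define t where "t = sqrt (v * m) * (1 + 9 / 5 * sqrt L)"
  have v: "0 < v" using W \<nu> by (simp add: v_def)
  have "0 < (K + 1) * L" using K L by simp
  then have m0: "0 < real m" using m by linarith
  have vm: "0 < sqrt (v * m)" using v m0 by simp
  have bound: "norm (y p *\<^sub>R W p) \<le> b" for p
  proof -
    have "(norm (y p *\<^sub>R W p))\<^sup>2 = (y p)\<^sup>2 * (norm (W p))\<^sup>2" by (simp add: power_mult_distrib)
    also have "\<dots> \<le> (K + 1) * \<nu> * r" using y W by (intro mult_mono) (auto intro: order_trans[OF _ y])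
    finally show ?thesis unfolding b_def v_def by (intro real_le_rsqrt) (simp add: mult_ac)
  qed
  have var: "(\<Sum>p\<in>UNIV. (norm (y p *\<^sub>R W p))\<^sup>2) / CARD('b) \<le> v"
  proof -
    have "(\<Sum>p\<in>UNIV. (norm (y p *\<^sub>R W p))\<^sup>2) \<le> (\<Sum>p\<in>UNIV. (y p)\<^sup>2 * r)"
      using W by (intro sum_mono) (simp add: power_mult_distrib mult_left_mono)
    also have "\<dots> = CARD('b) * v" by (simp add: sum_distrib_right[symmetric] \<nu> v_def)
    finally show ?thesis by (simp add: field_simps)
  qed
  have lb: "l * b \<le> 1"
  proof -
    have "l * b = sqrt ((K + 1) * L / m)"
      using v m0 K L by (simp add: l_def b_def real_sqrt_mult real_sqrt_divide)
    also have "\<dots> \<le> 1" using m m0 by simp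
    finally show ?thesis .
  qed
  have l2: "m * v * l\<^sup>2 = L" using v m0 L by (simp add: l_def power_divide)
  have lt: "l * t = sqrt L + 9 / 5 * L"
  proof -
    define S where "S = sqrt (v * m)"
    have "S \<noteq> 0" using vm by (simp only: S_def)
    then have "l * t = sqrt L * (1 + 9 / 5 * sqrt L)"
      unfolding l_def t_def S_def[symmetric] by simp
    also have "\<dots> = sqrt L + 9 / 5 * (sqrt L * sqrt L)" by (simp add: algebra_simps)
    finally show ?thesis using L by simp
  qed
  have "1 \<le> sqrt L" using L by simp
  have "measure_pmf.prob (uniform_draws m)
      {xs. t \<le> norm (sum_list (map (\<lambda>p. y p *\<^sub>R W p) xs))}
      \<le> 2 * exp (- l * t + m * (v * l\<^sup>2 / (2 * (1 - l * b / 3))))"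
  proof (rule Pinelis[OF orth bound var])
    show "0 \<le> l" using v m0 L by (simp add: l_def)
    show "l * b < 3" using lb by linarith
  qed
  \<comment> \<open>The exponent is at most \<open>- sqrt L - 9 / 5 * L + 3 / 4 * L\<close>, and
    \<open>sqrt L \<ge> 1\<close>. The surplus \<open>exp (- 1)\<close> will absorb the factor
    2.\<close>
  also have "\<dots> \<le> 2 * exp (- 1 - L)"
  proof -
    have "m * (v * l\<^sup>2 / (2 * (1 - l * b / 3))) = L / (2 * (1 - l * b / 3))"
      using l2 by (simp add: mult.assoc)
    also have "\<dots> \<le> L / (2 * (2 / 3))"
    proof (rule divide_left_mono)
      have "2 / 3 \<le> 1 - l * b / 3" using lb by simp
      then show "2 * (2 / 3) \<le> 2 * (1 - l * b / 3)" by (rule mult_left_mono) simp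
      then show "0 < 2 * (1 - l * b / 3) * (2 * (2 / 3))" by simp
    qed (use L in simp)
    finally have "m * (v * l\<^sup>2 / (2 * (1 - l * b / 3))) \<le> 3 / 4 * L" by simp
    then have "- (l * t) + m * (v * l\<^sup>2 / (2 * (1 - l * b / 3))) \<le> - 1 - L"
      unfolding lt using \<open>1 \<le> sqrt L\<close> L by linarith
    then show ?thesis by simp
  qed
  also have "\<dots> = 2 * exp (- 1) * exp (- L)" by (simp add: exp_diff exp_minus field_simps)
  also have "\<dots> \<le> 1 * exp (- L)"
  proof (rule mult_right_mono)
    show "2 * exp (- 1 :: real) \<le> 1"
      using exp_ge_add_one_self[of "1 :: real"] by (simp add: exp_minus field_simps)
  qed simp
  finally show ?thesis by (simp add: t_def v_def)
qed

text \<open>A positive lower bound on the residual forces \<open>m\<close> to be at least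
  \<open>4 * L + sqrt (2 * L * m * K) + 2 * L / 3 * K\<close>. The last summand shows that the
  square root is at least \<open>L * K\<close>, and then the first two suffice.\<close>

lemma sample_size_bound:
  fixes K L m D \<gamma> \<alpha> \<beta> :: real
  assumes K: "0 \<le> K" and L: "0 \<le> L" and m: "0 < m" and D: "1 \<le> D" and \<gamma>: "0 \<le> \<gamma>" "\<gamma> < 1"
    and \<beta>: "\<beta> = (1 + 2 * sqrt L)\<^sup>2"
    and \<alpha>: "m * \<alpha> = sqrt (2 * L * m * K) + 2 * L / 3 * K"
    and nontrivial: "D * (\<beta> / (1 - \<gamma>)) < m * (1 - \<alpha>)"
  shows "(K + 1) * L \<le> m"
proof -
  have "1 * \<beta> \<le> D * (\<beta> / (1 - \<gamma>))"
    using D \<gamma> by (intro mult_mono) (auto simp: \<beta> field_simps)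
  moreover have "4 * L \<le> \<beta>"
  proof -
    have "\<beta> = 1 + 4 * sqrt L + 4 * (sqrt L * sqrt L)"
      by (simp add: \<beta> power2_eq_square algebra_simps)
    then show ?thesis using L by simp
  qed
  ultimately have *: "4 * L + sqrt (2 * L * m * K) + 2 * L / 3 * K \<le> m"
    using nontrivial \<alpha> by (simp add: algebra_simps)
  have sqrt_nonneg: "0 \<le> sqrt (2 * L * m * K)" using K L m by simp
  have KL: "0 \<le> L * K" using K L by simp
  have "L * K \<le> sqrt (2 * L * m * K)"
  proof (rule real_le_rsqrt)
    have "2 * L / 3 * K \<le> m" using * sqrt_nonneg L by linarith
    then have "2 * (L * K) * (2 * L / 3 * K) \<le> 2 * (L * K) * m"
      using KL by (intro mult_left_mono) auto
    moreover have "(L * K)\<^sup>2 \<le> 2 * (L * K) * (2 * L / 3 * K)"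
      using mult_nonneg_nonneg[OF KL KL] by (simp add: power2_eq_square algebra_simps)
    ultimately show "(L * K)\<^sup>2 \<le> 2 * L * m * K" by (simp add: algebra_simps)
  qed
  with * KL L show ?thesis by (simp add: algebra_simps)
qed

text \<open>The lower tail of \<open>\<parallel>y\<^sub>\<Omega>\<parallel>\<^sup>2\<close> misses its target by \<open>2 L / 3\<close>; the vector bound with
  \<open>9 / 5\<close> in place of the \<open>2\<close> of \<open>\<beta>\<close> leaves room for it.\<close>
lemma residual_slack:
  fixes L D \<gamma> \<beta> :: real
  assumes L: "0 \<le> L" and D: "1 \<le> D" and \<gamma>: "0 \<le> \<gamma>" "\<gamma> < 1" and \<beta>: "\<beta> = (1 + 2 * sqrt L)\<^sup>2"
  shows "2 * L / 3 + D * (1 + 9 / 5 * sqrt L)\<^sup>2 / (1 - \<gamma>) \<le> D * (\<beta> / (1 - \<gamma>))"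
proof -
  \<comment> \<open>The coefficient of \<open>L\<close> is \<open>4 - (9 / 5)^2 = 19 / 25\<close>,
    which exceeds the required \<open>2 / 3\<close>.\<close>
  have sq: "\<beta> - (1 + 9 / 5 * sqrt L)\<^sup>2 = 2 / 5 * sqrt L + 19 / 25 * L"
    using L by (simp add: \<beta> power2_eq_square algebra_simps)
  also have "\<dots> \<ge> 2 * L / 3" using L real_sqrt_ge_zero[OF L] by linarith
  finally have "2 * L / 3 \<le> \<beta> - (1 + 9 / 5 * sqrt L)\<^sup>2" .
  also have "\<dots> = 1 * (\<beta> - (1 + 9 / 5 * sqrt L)\<^sup>2)" by simp
  also have "\<dots> \<le> D / (1 - \<gamma>) * (\<beta> - (1 + 9 / 5 * sqrt L)\<^sup>2)"
  proof (rule mult_right_mono)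
    show "1 \<le> D / (1 - \<gamma>)" using D \<gamma> by simp
    show "0 \<le> \<beta> - (1 + 9 / 5 * sqrt L)\<^sup>2" unfolding sq using L by simp
  qed
  also have "\<dots> = D * (\<beta> / (1 - \<gamma>)) - D * (1 + 9 / 5 * sqrt L)\<^sup>2 / (1 - \<gamma>)"
    by (simp only: right_diff_distrib times_divide_eq_left times_divide_eq_right diff_divide_distrib)
  finally show ?thesis by linarith
qed

lemma norm_square_sum_mset_unit:
  fixes W :: "'b \<Rightarrow> real^'n"
  assumes "\<And>v. norm v = 1 \<Longrightarrow> \<kappa> < (\<Sum>p\<in>#\<Omega>. (W p \<bullet> v)\<^sup>2)" "v \<noteq> 0"
  shows "\<kappa> * (norm v)\<^sup>2 < (\<Sum>p\<in>#\<Omega>. (W p \<bullet> v)\<^sup>2)"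
proof -
  define u where "u = v /\<^sub>R norm v"
  have v: "v = norm v *\<^sub>R u" using assms(2) by (simp add: u_def)
  have "(\<Sum>p\<in>#\<Omega>. (W p \<bullet> (a *\<^sub>R u))\<^sup>2) = a\<^sup>2 * (\<Sum>p\<in>#\<Omega>. (W p \<bullet> u)\<^sup>2)" for a
    by (induction \<Omega>) (simp_all add: power_mult_distrib distrib_left)
  then have "(\<Sum>p\<in>#\<Omega>. (W p \<bullet> v)\<^sup>2) = (norm v)\<^sup>2 * (\<Sum>p\<in>#\<Omega>. (W p \<bullet> u)\<^sup>2)"
    by (metis v)
  moreover have "\<kappa> < (\<Sum>p\<in>#\<Omega>. (W p \<bullet> u)\<^sup>2)"
    using assms by (intro assms(1)) (simp add: u_def)
  ultimately show ?thesis using assms(2) by (simp add: mult.commute)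
qed

lemma component_square_le_infnorm: "(y $ p)\<^sup>2 \<le> (infnorm (y :: real^'p))\<^sup>2"
  using power_mono[OF component_le_infnorm_cart[of y p], of 2] by simp

text \<open>The probabilistic core, free of tensors and projections. \<open>P\<close> is any
  property implied by positive definiteness of the sampled Gram matrix and the two bounds;
  \<open>R\<close> stands for the residual, of which only nonnegativity and the estimate with
  \<open>\<kappa>\<close> are used.\<close>

lemma sampled_residual_probability:
  fixes W :: "real^'q^'p" and y :: "real^'p" and \<delta> D \<alpha> \<beta> \<gamma> :: real and m :: nat
  assumes W: "gram W = mat 1" "\<And>p. (norm (W $ p))\<^sup>2 \<le> D / CARD('p)" "CARD('q) \<le> D"
    and orth: "(\<Sum>p\<in>UNIV. y $ p *\<^sub>R W $ p) = 0"
    and \<delta>: "0 < \<delta>" "\<delta> < 1 / 4"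
    and m: "8 / 3 * D * ln (2 * real CARD('q) / \<delta>) \<le> m"
    and \<alpha>: "\<alpha> = sqrt (2 * (CARD('p) * (infnorm y)\<^sup>2 - (norm y)\<^sup>2) / (m * (norm y)\<^sup>2) * ln (1 / \<delta>))
              + 2 * (CARD('p) * (infnorm y)\<^sup>2 - (norm y)\<^sup>2) / (3 * m * (norm y)\<^sup>2) * ln (1 / \<delta>)"
    and \<beta>: "\<beta> = (1 + 2 * sqrt (ln (1 / \<delta>)))\<^sup>2"
    and \<gamma>: "\<gamma> = sqrt (8 * D / (3 * m) * ln (2 * real CARD('q) / \<delta>))"
    and P: "\<And>xs. \<lbrakk>\<And>v. v \<noteq> 0 \<Longrightarrow> 0 < (\<Sum>p\<in>#mset xs. (W $ p \<bullet> v)\<^sup>2);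
        (\<Sum>p\<in>#mset xs. (y $ p)\<^sup>2) \<le> (1 + \<alpha>) * (m / CARD('p)) * (norm y)\<^sup>2;
        \<And>R. \<lbrakk>0 \<le> R; \<gamma> \<noteq> 1; \<And>\<kappa>. \<lbrakk>0 < \<kappa>; \<And>v. \<kappa> * (norm v)\<^sup>2 \<le> (\<Sum>p\<in>#mset xs. (W $ p \<bullet> v)\<^sup>2)\<rbrakk>
              \<Longrightarrow> (\<Sum>p\<in>#mset xs. (y $ p)\<^sup>2) - (norm (\<Sum>p\<in>#mset xs. y $ p *\<^sub>R W $ p))\<^sup>2 / \<kappa> \<le> R\<rbrakk>
           \<Longrightarrow> (m * (1 - \<alpha>) - D * (\<beta> / (1 - \<gamma>))) / CARD('p) * (norm y)\<^sup>2 \<le> R\<rbrakk> \<Longrightarrow> P xs"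
  shows "1 - 4 * \<delta> \<le> measure_pmf.prob (uniform_draws m) {xs. P xs}"
proof -
  let ?\<mu> = "uniform_draws m :: 'p list pmf"
  define N where "N = real CARD('p)"
  define L where "L = ln (1 / \<delta>)"
  define \<nu> where "\<nu> = (norm y)\<^sup>2 / N"
  define K where "K = (N * (infnorm y)\<^sup>2 - (norm y)\<^sup>2) / (norm y)\<^sup>2"
  define Z where "Z p = (y $ p)\<^sup>2 - \<nu>" for p
  define V where "V p = y $ p *\<^sub>R W $ p" for p
  define x where "x = ln (2 * real CARD('q) / \<delta>)"
  have N: "0 < N" by (simp add: N_def)
  have q: "1 \<le> real CARD('q)" by (simp add: Suc_le_eq)
  have D: "1 \<le> D" using q W(3) by linarith
  \<comment> \<open>From \<open>\<delta> < 1 / 4\<close> the reciprocal of \<open>\<delta>\<close>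
    exceeds Euler's number; \<open>L \<ge> 1\<close> is what the vector tail needs.\<close>
  have L1: "1 \<le> L"
  proof -
    have "4 \<le> 1 / \<delta>" using \<delta> by (simp add: field_simps)
    then have "exp 1 \<le> 1 / \<delta>" using exp_le by linarith
    then show ?thesis unfolding L_def using \<delta> by (subst ln_ge_iff) auto
  qed
  then have L: "0 \<le> L" by simp
  have exp_L: "exp (- L) = \<delta>" using \<delta> by (simp add: L_def ln_div)
  have "\<delta> < 2 * CARD('q)" using \<delta> q by linarith
  then have x: "0 < x" unfolding x_def using \<delta> by (subst ln_gt_zero_iff) auto
  have "0 < 8 / 3 * D * x" using D x by simp
  then have m0: "0 < real m" using m unfolding x_def by linarith
  have \<gamma>_sq: "\<gamma>\<^sup>2 = 8 * D / (3 * m) * x" using D x m0 by (simp add: \<gamma> x_def)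
  have \<gamma>0: "0 \<le> \<gamma>" using D x by (simp add: \<gamma> x_def)
  have "\<gamma>\<^sup>2 \<le> 1" using m m0 by (simp add: \<gamma>_sq x_def field_simps)
  then have \<gamma>1: "\<gamma> \<le> 1" using \<gamma>0 by (simp add: power_le_one_iff abs_square_le_1)
  define B1 where "B1 = {xs. \<exists>v. norm v = 1 \<and> (\<Sum>p\<leftarrow>xs. (W $ p \<bullet> v)\<^sup>2) \<le> (1 - \<gamma>) * m / N}"
  define B2 where "B2 = {xs. y \<noteq> 0 \<and> \<nu> * (sqrt (2 * L * m * K) + 2 * L / 3 * K) < sum_list (map Z xs)}"
  define B3 where "B3 = {xs. y \<noteq> 0 \<and> sum_list (map Z xs) < - (\<nu> * (sqrt (2 * L * m * K) + 2 * L / 3 * (K + 1)))}"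
  \<comment> \<open>The sample size condition is part of the event: where it fails, the claimed
    lower bound is not positive and no vector tail is required. The guard
    \<open>y \<noteq> 0\<close> excludes the degenerate \<open>\<nu> = 0\<close>.\<close>
  define B4 where "B4 = {xs. y \<noteq> 0 \<and> (K + 1) * L \<le> m \<and>
      sqrt (D / N * \<nu> * m) * (1 + 9 / 5 * sqrt L) \<le> norm (sum_list (map V xs))}"
  have B1: "measure_pmf.prob ?\<mu> B1 \<le> \<delta>"
  proof -
    have "measure_pmf.prob ?\<mu> B1 \<le> CARD('q) * exp (- (m * \<gamma>\<^sup>2 / (2 * D)))"
      unfolding B1_def N_def
      by (rule matrix_Chernoff[OF sum_outer_rows[OF W(1)] W(2)]) (use D \<gamma>0 in auto)
    \<comment> \<open>The exponent exceeds \<open>x\<close>, and \<open>exp (- x)\<close> already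
      brings the bound down to \<open>\<delta> / 2\<close>.\<close>
    also have "m * \<gamma>\<^sup>2 / (2 * D) = 4 / 3 * x"
      using m0 D by (simp add: \<gamma>_sq field_simps)
    also have "CARD('q) * exp (- (4 / 3 * x)) \<le> CARD('q) * exp (- x)"
      using x by (intro mult_left_mono) auto
    also have "\<dots> = \<delta> / 2" using \<delta> q by (simp add: x_def exp_minus)
    finally show ?thesis using \<delta> by simp
  qed
  have K: "0 \<le> K"
  proof -
    have "(norm y)\<^sup>2 \<le> (\<Sum>p\<in>(UNIV :: 'p set). (infnorm y)\<^sup>2)"
      unfolding norm_vec_square by (intro sum_mono) (simp add: component_square_le_infnorm)
    then show ?thesis by (simp add: K_def N_def)
  qed
  have tails: "0 < \<nu>" "(\<Sum>p\<in>UNIV. (y $ p)\<^sup>2) = CARD('p) * \<nu>" "(y $ p)\<^sup>2 \<le> (K + 1) * \<nu>"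
    if "y \<noteq> 0" for p
  proof -
    show "0 < \<nu>" using that N by (simp add: \<nu>_def)
    show "(\<Sum>p\<in>UNIV. (y $ p)\<^sup>2) = CARD('p) * \<nu>"
      by (simp add: \<nu>_def N_def norm_vec_square)
    have "(K + 1) * \<nu> = (infnorm y)\<^sup>2"
      using that N by (simp add: K_def \<nu>_def field_simps)
    then show "(y $ p)\<^sup>2 \<le> (K + 1) * \<nu>"
      by (simp add: component_square_le_infnorm)
  qed
  have B2: "measure_pmf.prob ?\<mu> B2 \<le> \<delta>" and B3: "measure_pmf.prob ?\<mu> B3 \<le> \<delta>"
  proof -
    show "measure_pmf.prob ?\<mu> B2 \<le> \<delta>"
    proof (cases "y = 0")
      case False
      from square_sample_tails(1)[OF tails(2,1,3)[OF this] K _ L] False m0 show ?thesis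
        by (simp add: B2_def Z_def[abs_def] exp_L)
    qed (use \<delta> in \<open>simp add: B2_def\<close>)
    show "measure_pmf.prob ?\<mu> B3 \<le> \<delta>"
    proof (cases "y = 0")
      case False
      from square_sample_tails(2)[OF tails(2,1,3)[OF this] K _ L] False m0 show ?thesis
        by (simp add: B3_def Z_def[abs_def] exp_L)
    qed (use \<delta> in \<open>simp add: B3_def\<close>)
  qed
  have B4: "measure_pmf.prob ?\<mu> B4 \<le> \<delta>"
  proof (cases "y \<noteq> 0 \<and> (K + 1) * L \<le> m")
    case True
    then have "y \<noteq> 0" "(K + 1) * L \<le> m" by simp_all
    from weighted_row_sample_tail[where r = "D / N" and W = "\<lambda>p. W $ p",
        OF tails(2,1,3)[OF this(1)] _ _ orth K L1 this(2)]
    have "measure_pmf.prob ?\<mu> {xs. sqrt (D / N * \<nu> * m) * (1 + 9 / 5 * sqrt L)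
        \<le> norm (sum_list (map V xs))} \<le> \<delta>"
      using W(2) D N by (simp add: V_def[abs_def] N_def exp_L)
    with True show ?thesis by (simp add: B4_def)
  next
    case False
    then have "B4 = {}" by (auto simp: B4_def)
    then show ?thesis using \<delta> by simp
  qed
  have good: "P xs" if xs: "length xs = m" "xs \<notin> B1" "xs \<notin> B2" "xs \<notin> B3" "xs \<notin> B4" for xs
  proof (rule P)
    have mset: "(\<Sum>p\<in>#mset xs. f p) = sum_list (map f xs)" for f :: "'p \<Rightarrow> 'c::comm_monoid_add"
      by (metis mset_map sum_mset_sum_list)
    have unit: "(1 - \<gamma>) * m / N < (\<Sum>p\<in>#mset xs. (W $ p \<bullet> v)\<^sup>2)" if "norm v = 1" for v
      using xs(2) that by (auto simp: B1_def mset not_le)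
    have form: "(1 - \<gamma>) * m / N * (norm v)\<^sup>2 < (\<Sum>p\<in>#mset xs. (W $ p \<bullet> v)\<^sup>2)" if "v \<noteq> 0" for v
      by (rule norm_square_sum_mset_unit[OF unit that])
    \<comment> \<open>Outside \<open>B1\<close> the inequality in \<open>form\<close> is strict, so
      the Gram matrix is positive definite even when \<open>\<gamma> = 1\<close>.\<close>
    show "0 < (\<Sum>p\<in>#mset xs. (W $ p \<bullet> v)\<^sup>2)" if "v \<noteq> 0" for v
    proof -
      have "0 \<le> (1 - \<gamma>) * m / N * (norm v)\<^sup>2" using \<gamma>1 N by simp
      with form[OF that] show ?thesis by linarith
    qed
    have sum_Z: "(\<Sum>p\<in>#mset xs. (y $ p)\<^sup>2) = m * \<nu> + sum_list (map Z xs)"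
    proof -
      have "sum_list (map Z zs) = (\<Sum>p\<leftarrow>zs. (y $ p)\<^sup>2) - length zs * \<nu>" for zs
        by (induction zs) (simp_all add: Z_def algebra_simps)
      then show ?thesis by (simp add: mset xs(1))
    qed
    have m\<alpha>: "m * \<alpha> = sqrt (2 * L * m * K) + 2 * L / 3 * K"
    proof -
      have "\<alpha> = sqrt (2 * K / m * L) + 2 * K / (3 * m) * L"
        unfolding \<alpha> K_def L_def N_def by (simp add: field_simps)
      moreover have "m * sqrt (2 * K / m * L) = sqrt (2 * L * m * K)"
      proof -
        have "m * sqrt (2 * K / m * L) = sqrt (m\<^sup>2 * (2 * K / m * L))"
          using m0 by (simp only: real_sqrt_mult) simp
        also have "m\<^sup>2 * (2 * K / m * L) = 2 * L * m * K"
          using m0 by (simp add: power2_eq_square)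
        finally show ?thesis .
      qed
      ultimately show ?thesis using m0 by (simp add: algebra_simps)
    qed
    have y0: "(\<Sum>p\<in>#mset xs. (y $ p)\<^sup>2) = 0" if "y = 0" using that by simp
    show "(\<Sum>p\<in>#mset xs. (y $ p)\<^sup>2) \<le> (1 + \<alpha>) * (m / CARD('p)) * (norm y)\<^sup>2"
    proof (cases "y = 0")
      case False
      with xs(3) have "sum_list (map Z xs) \<le> \<nu> * (m * \<alpha>)"
        by (simp add: B2_def not_less m\<alpha>)
      then have "(\<Sum>p\<in>#mset xs. (y $ p)\<^sup>2) \<le> m * \<nu> + \<nu> * (m * \<alpha>)" by (simp add: sum_Z)
      also have "\<dots> = (1 + \<alpha>) * (m / CARD('p)) * (norm y)\<^sup>2"
        by (simp add: \<nu>_def N_def algebra_simps add_divide_distrib)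
      finally show ?thesis .
    qed (simp add: y0)
    fix R
    assume R: "0 \<le> R" and "\<gamma> \<noteq> 1"
      and res: "\<And>\<kappa>. \<lbrakk>0 < \<kappa>; \<And>v. \<kappa> * (norm v)\<^sup>2 \<le> (\<Sum>p\<in>#mset xs. (W $ p \<bullet> v)\<^sup>2)\<rbrakk>
        \<Longrightarrow> (\<Sum>p\<in>#mset xs. (y $ p)\<^sup>2) - (norm (\<Sum>p\<in>#mset xs. y $ p *\<^sub>R W $ p))\<^sup>2 / \<kappa> \<le> R"
    then have \<gamma>1': "\<gamma> < 1" using \<gamma>1 by simp
    show "(m * (1 - \<alpha>) - D * (\<beta> / (1 - \<gamma>))) / CARD('p) * (norm y)\<^sup>2 \<le> R"
    \<comment> \<open>A bound that is not positive holds because \<open>R \<ge> 0\<close>. In the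
      remaining case \<open>sample_size_bound\<close> makes the vector tail available.\<close>
    proof (cases "y = 0 \<or> m * (1 - \<alpha>) \<le> D * (\<beta> / (1 - \<gamma>))")
      case True
      then have "(m * (1 - \<alpha>) - D * (\<beta> / (1 - \<gamma>))) / CARD('p) * (norm y)\<^sup>2 \<le> 0"
        by (cases "y = 0", simp, intro mult_nonpos_nonneg divide_nonpos_nonneg, auto)
      with R show ?thesis by linarith
    next
      case False
      then have y: "y \<noteq> 0" and nontrivial: "D * (\<beta> / (1 - \<gamma>)) < m * (1 - \<alpha>)" by simp_all
      have KL: "(K + 1) * L \<le> m"
        by (rule sample_size_bound[OF K L m0 D \<gamma>0 \<gamma>1' \<beta>[folded L_def] m\<alpha> nontrivial])
      have \<nu>: "0 < \<nu>" by (rule tails(1)[OF y])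
      define \<kappa> where "\<kappa> = (1 - \<gamma>) * m / N"
      define w where "w = 1 + 9 / 5 * sqrt L"
      have \<kappa>: "0 < \<kappa>" using \<gamma>1' m0 N by (simp add: \<kappa>_def)
      have "(norm (\<Sum>p\<in>#mset xs. y $ p *\<^sub>R W $ p))\<^sup>2 \<le> (sqrt (D / N * \<nu> * m) * w)\<^sup>2"
        using xs(5) y KL by (intro power_mono) (simp_all add: B4_def mset V_def[abs_def] w_def)
      also have "\<dots> = D / N * \<nu> * m * w\<^sup>2"
        using D N \<nu> by (simp add: power_mult_distrib)
      finally have "(norm (\<Sum>p\<in>#mset xs. y $ p *\<^sub>R W $ p))\<^sup>2 / \<kappa> \<le> D / N * \<nu> * m * w\<^sup>2 / \<kappa>"
        using \<kappa> by (intro divide_right_mono) auto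
      also have "\<dots> = \<nu> * (D * w\<^sup>2 / (1 - \<gamma>))"
        using m0 N by (simp add: \<kappa>_def)
      finally have vec: "(norm (\<Sum>p\<in>#mset xs. y $ p *\<^sub>R W $ p))\<^sup>2 / \<kappa> \<le> \<nu> * (D * w\<^sup>2 / (1 - \<gamma>))" .
      have "\<kappa> * (norm v)\<^sup>2 \<le> (\<Sum>p\<in>#mset xs. (W $ p \<bullet> v)\<^sup>2)" for v
        using form[of v] by (cases "v = 0") (simp_all add: \<kappa>_def)
      from res[OF \<kappa> this]
      have "(\<Sum>p\<in>#mset xs. (y $ p)\<^sup>2) - \<nu> * (D * w\<^sup>2 / (1 - \<gamma>)) \<le> R"
        using vec by linarith
      moreover have "m * \<nu> - \<nu> * (m * \<alpha> + 2 * L / 3) \<le> (\<Sum>p\<in>#mset xs. (y $ p)\<^sup>2)"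
      proof -
        have "sqrt (2 * L * m * K) + 2 * L / 3 * (K + 1) = m * \<alpha> + 2 * L / 3"
          unfolding m\<alpha> by (simp add: algebra_simps)
        then have "- (\<nu> * (m * \<alpha> + 2 * L / 3)) \<le> sum_list (map Z xs)"
          using xs(4) y by (simp only: B3_def) (simp add: not_less)
        then show ?thesis by (simp add: sum_Z)
      qed
      moreover have "\<nu> * (2 * L / 3 + D * w\<^sup>2 / (1 - \<gamma>)) \<le> \<nu> * (D * (\<beta> / (1 - \<gamma>)))"
        unfolding w_def using \<nu>
        by (intro mult_left_mono residual_slack L D \<gamma>0 \<gamma>1' \<beta>[folded L_def]) simp
      ultimately have "m * \<nu> - \<nu> * (m * \<alpha>) - \<nu> * (D * (\<beta> / (1 - \<gamma>))) \<le> R"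
        by (simp add: distrib_left)
      moreover have "m * \<nu> - \<nu> * (m * \<alpha>) - \<nu> * (D * (\<beta> / (1 - \<gamma>)))
          = (m * (1 - \<alpha>) - D * (\<beta> / (1 - \<gamma>))) * \<nu>" by (simp add: algebra_simps)
      ultimately show ?thesis by (simp add: \<nu>_def N_def)
    qed
  qed
  have "measure_pmf.prob ?\<mu> (B1 \<union> B2 \<union> B3 \<union> B4) \<le> measure_pmf.prob ?\<mu> B1
      + measure_pmf.prob ?\<mu> B2 + measure_pmf.prob ?\<mu> B3 + measure_pmf.prob ?\<mu> B4"
    by (intro order_trans[OF measure_Un_le] add_mono order_refl) auto
  then have "measure_pmf.prob ?\<mu> (B1 \<union> B2 \<union> B3 \<union> B4) \<le> 4 * \<delta>"
    using B1 B2 B3 B4 by linarith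
  moreover have "measure_pmf.prob ?\<mu> (- (B1 \<union> B2 \<union> B3 \<union> B4)) = 1 - measure_pmf.prob ?\<mu> (B1 \<union> B2 \<union> B3 \<union> B4)"
    using measure_pmf.prob_compl[of "B1 \<union> B2 \<union> B3 \<union> B4" ?\<mu>] by (simp add: Compl_eq_Diff_UNIV)
  moreover have "measure_pmf.prob ?\<mu> (- (B1 \<union> B2 \<union> B3 \<union> B4)) \<le> measure_pmf.prob ?\<mu> {xs. P xs}"
  proof (intro measure_pmf.finite_measure_mono_AE)
    show "AE xs in ?\<mu>. xs \<in> - (B1 \<union> B2 \<union> B3 \<union> B4) \<longrightarrow> xs \<in> {xs. P xs}"
      by (auto simp: AE_measure_pmf_iff set_replicate_pmf intro!: good)
  qed simp_all
  ultimately show ?thesis by linarith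
qed

text \<open>The event includes invertibility of the sampled Gram matrix, without which
  \<open>column_proj\<close> would be built on an unspecified inverse. If a positive
  \<open>m\<close> meets its lower bound with equality, then \<open>\<gamma> = 1\<close> and the
  quotient by \<open>1 - \<gamma>\<close> has no finite meaning; the lower bound is guarded
  accordingly.\<close>

theorem theorem2:
  fixes M :: "real^'n3^'n3"
    and U :: "real^'n3^'n2^'n1"
    and T X Y :: "real^'n3^1^'n1"
    and S :: "(real^('n1 \<times> 'n3)) set"
    and x y :: "real^('n1 \<times> 'n3)"
    and c \<theta> \<delta> \<mu> \<alpha> \<beta> \<gamma> :: real
    and n1 n2 n3 m :: nat
  assumes dims: "n1 = CARD('n1)" "n2 = CARD('n2)" "n3 = CARD('n3)"
    and transform: "invertible M" "0 < c" "c \<le> onorm (\<lambda>a. M *v a)"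
      "\<And>a. norm (tube_L M a) = c * norm a"
    and orthonormal: "tensor_prod M (tensor_transpose M U) U = tensor_id M"
    and S: "S = span (columns (lmat M U))"
    and \<mu>: "\<mu> = coherence n1 n2 S"
    and T_decomp: "T = X + Y" "X \<in> tensor_column_space M U" "Y \<in> tensor_orth_space M U"
    and t_decomp: "unfold T = x + y" "x \<in> S" "y \<in> orthogonal_comp S"
    and \<theta>: "cos \<theta> = norm (orth_proj (orthogonal_comp S) (unfold Y)) / norm (unfold Y)"
    and \<delta>: "\<delta> > 0"
    and m: "real m \<ge> 8 / 3 * n2 * n3 * \<mu> * ln (2 * n2 * n3 / \<delta>)"
    and \<alpha>: "\<alpha> = sqrt (2 * (n1 * n3 * (infnorm y)\<^sup>2 - (norm y)\<^sup>2) / (m * (norm y)\<^sup>2) * ln (1 / \<delta>))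
              + 2 * (n1 * n3 * (infnorm y)\<^sup>2 - (norm y)\<^sup>2) / (3 * m * (norm y)\<^sup>2) * ln (1 / \<delta>)"
    and \<beta>: "\<beta> = (1 + 2 * sqrt (ln (1 / \<delta>)))\<^sup>2"
    and \<gamma>: "\<gamma> = sqrt (8 * n2 * n3 * \<mu> / (3 * m) * ln (2 * n2 * n3 / \<delta>))"
  shows "measure_pmf.prob (replicate_pmf m (pmf_of_set (UNIV :: ('n1 \<times> 'n3) set)))
     {draws.
        let \<Omega> = mset draws;
            t\<^sub>\<Omega> = unfold (sample_tensor \<Omega> T);
            U\<^sub>\<Omega> = sample_rows \<Omega> (lmat M U);
            P\<^sub>\<Omega> = column_proj U\<^sub>\<Omega>;
            residual = (norm (T - tensor_prod M (tensor_proj M U) T))\<^sup>2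
        in invertible (gram U\<^sub>\<Omega>)
         \<and> (\<gamma> \<noteq> 1 \<longrightarrow>
              (m * (1 - \<alpha>) - n2 * n3 * \<mu> * (\<beta> / (1 - \<gamma>))) / (n1 * n3) * (cos \<theta>)\<^sup>2 * residual
              \<le> (norm (t\<^sub>\<Omega> - P\<^sub>\<Omega> *v t\<^sub>\<Omega>))\<^sup>2)
         \<and> (norm (t\<^sub>\<Omega> - P\<^sub>\<Omega> *v t\<^sub>\<Omega>))\<^sup>2
              \<le> (1 + \<alpha>) * (m / (n1 * n3)) * (cos \<theta>)\<^sup>2 * residual}
    \<ge> 1 - 4 * \<delta>"
proof (cases "\<delta> < 1 / 4")
  \<comment> \<open>The claimed probability is then not positive.\<close>
  case False
  then have "1 - 4 * \<delta> \<le> 0" by simp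
  then show ?thesis by (rule order_trans) (rule measure_nonneg)
next
  case True
  define W where "W = lmat M U"
  define D where "D = real n2 * real n3 * \<mu>"
  have W: "gram W = mat 1"
    unfolding W_def by (rule gram_lmat[OF transform(1,2,4) orthonormal])
  have q: "real CARD('n2 \<times> 'n3) = real n2 * real n3" and p: "real CARD('n1 \<times> 'n3) = real n1 * real n3"
    by (simp_all add: dims)
  have "0 < n1" "n2 * n3 = CARD('n2 \<times> 'n3)" "n1 * n3 = CARD('n1 \<times> 'n3)"
    by (simp_all add: dims)
  note coh = coherence_properties[OF W this, folded S[folded W_def], folded \<mu>, folded D_def]
  have orth: "(\<Sum>p\<in>UNIV. y $ p *\<^sub>R W $ p) = 0"
    using orthogonal_comp_columns t_decomp(3) by (simp add: S W_def)
  \<comment> \<open>The angle and the tensor residual enter both bounds only through this product,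
    which turns them into bounds in terms of \<open>y\<close>.\<close>
  have residual: "(cos \<theta>)\<^sup>2 * (norm (T - tensor_prod M (tensor_proj M U) T))\<^sup>2 = (norm y)\<^sup>2"
  proof -
    have proj: "orth_proj (orthogonal_comp S) (unfold Y) = y"
      by (rule orth_proj_unfold_orth_space[OF S T_decomp(1,2) t_decomp])
    have Y: "T - tensor_prod M (tensor_proj M U) T = Y"
      by (rule tensor_proj_residual[OF transform(1) orthonormal T_decomp])
    show ?thesis
    proof (cases "Y = 0")
      \<comment> \<open>For \<open>Y = 0\<close> the cosine is a quotient with denominator zero, but
        \<open>y\<close> vanishes too, being the projection of zero.\<close>
      case True
      then have "unfold Y = 0" by (simp add: unfold_def vec_eq_iff)
      then have "orth_proj (orthogonal_comp S) (unfold Y) = 0"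
        by (intro orth_proj_eqI subspace_orthogonal_comp)
          (simp_all add: subspace_0[OF subspace_orthogonal_comp])
      then show ?thesis using proj Y True by simp
    next
      case False
      then show ?thesis by (simp add: \<theta> proj Y norm_unfold power_divide)
    qed
  qed
  \<comment> \<open>Since \<open>x\<close> is in the range of \<open>W\<close>, its sample is in the
    range of the sampled rows and drops out of the residual.\<close>
  obtain a where a: "x = W *v a"
    using t_decomp(2) by (auto simp: S W_def span_columns_eq_range)
  show ?thesis
  proof (rule sampled_residual_probability[where W = W and y = y and D = D
        and \<alpha> = \<alpha> and \<beta> = \<beta> and \<gamma> = \<gamma>, OF W coh orth \<delta> True _ _ \<beta>])
    show "8 / 3 * D * ln (2 * real CARD('n2 \<times> 'n3) / \<delta>) \<le> real m"
      using m by (simp only: q D_def mult.assoc of_nat_mult of_nat_numeral)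
    show "\<alpha> = sqrt (2 * (real CARD('n1 \<times> 'n3) * (infnorm y)\<^sup>2 - (norm y)\<^sup>2) / (m * (norm y)\<^sup>2) * ln (1 / \<delta>))
        + 2 * (real CARD('n1 \<times> 'n3) * (infnorm y)\<^sup>2 - (norm y)\<^sup>2) / (3 * m * (norm y)\<^sup>2) * ln (1 / \<delta>)"
      using \<alpha> by (simp only: p of_nat_mult of_nat_numeral)
    show "\<gamma> = sqrt (8 * D / (3 * m) * ln (2 * real CARD('n2 \<times> 'n3) / \<delta>))"
      using \<gamma> by (simp only: q D_def mult.assoc of_nat_mult of_nat_numeral)
    fix xs :: "('n1 \<times> 'n3) list"
    define A where "A = sample_rows (mset xs) W"
    define z where "z = sample_vec (mset xs) y"
    have t: "unfold (sample_tensor (mset xs) T) = A *v a + z"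
      by (simp add: unfold_sample_tensor t_decomp(1) sample_vec_add a sample_vec_mult A_def z_def)
    have form: "v \<bullet> (gram A *v v) = (\<Sum>p\<in>#mset xs. (W $ p \<bullet> v)\<^sup>2)" for v
      by (simp only: A_def gram_sample_rows_form)
    assume pos: "\<And>v. v \<noteq> 0 \<Longrightarrow> 0 < (\<Sum>p\<in>#mset xs. (W $ p \<bullet> v)\<^sup>2)"
      and upper: "(\<Sum>p\<in>#mset xs. (y $ p)\<^sup>2) \<le> (1 + \<alpha>) * (m / real CARD('n1 \<times> 'n3)) * (norm y)\<^sup>2"
      and lower: "\<And>R. \<lbrakk>0 \<le> R; \<gamma> \<noteq> 1; \<And>\<kappa>. \<lbrakk>0 < \<kappa>; \<And>v. \<kappa> * (norm v)\<^sup>2 \<le> (\<Sum>p\<in>#mset xs. (W $ p \<bullet> v)\<^sup>2)\<rbrakk>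
              \<Longrightarrow> (\<Sum>p\<in>#mset xs. (y $ p)\<^sup>2) - (norm (\<Sum>p\<in>#mset xs. y $ p *\<^sub>R W $ p))\<^sup>2 / \<kappa> \<le> R\<rbrakk>
           \<Longrightarrow> (m * (1 - \<alpha>) - D * (\<beta> / (1 - \<gamma>))) / real CARD('n1 \<times> 'n3) * (norm y)\<^sup>2 \<le> R"
    have inv: "invertible (gram A)"
      by (rule invertible_gram) (unfold form, rule pos)
    define R where "R = (norm ((A *v a + z) - column_proj A *v (A *v a + z)))\<^sup>2"
    have "R \<le> (1 + \<alpha>) * (m / real CARD('n1 \<times> 'n3)) * (norm y)\<^sup>2"
      using column_proj_residual(1)[OF inv, of a z] upper by (simp only: R_def z_def norm_sample_vec)
    moreover have "\<gamma> \<noteq> 1 \<longrightarrow>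
        (m * (1 - \<alpha>) - D * (\<beta> / (1 - \<gamma>))) / real CARD('n1 \<times> 'n3) * (norm y)\<^sup>2 \<le> R"
    proof
      assume "\<gamma> \<noteq> 1"
      then show "(m * (1 - \<alpha>) - D * (\<beta> / (1 - \<gamma>))) / real CARD('n1 \<times> 'n3) * (norm y)\<^sup>2 \<le> R"
      proof (rule lower[rotated])
        show "0 \<le> R" by (simp add: R_def)
        fix \<kappa> :: real
        assume \<kappa>: "0 < \<kappa>" "\<And>v. \<kappa> * (norm v)\<^sup>2 \<le> (\<Sum>p\<in>#mset xs. (W $ p \<bullet> v)\<^sup>2)"
        have "(norm z)\<^sup>2 - (norm (transpose A *v z))\<^sup>2 / \<kappa> \<le> R"
          unfolding R_def by (rule column_proj_residual(2)[OF inv \<kappa>(1)]) (simp only: form \<kappa>(2))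
        then show "(\<Sum>p\<in>#mset xs. (y $ p)\<^sup>2) - (norm (\<Sum>p\<in>#mset xs. y $ p *\<^sub>R W $ p))\<^sup>2 / \<kappa> \<le> R"
          unfolding z_def A_def transpose_sample_rows_mult norm_sample_vec .
      qed
    qed
    ultimately show "let \<Omega> = mset xs;
            t\<^sub>\<Omega> = unfold (sample_tensor \<Omega> T);
            U\<^sub>\<Omega> = sample_rows \<Omega> (lmat M U);
            P\<^sub>\<Omega> = column_proj U\<^sub>\<Omega>;
            residual = (norm (T - tensor_prod M (tensor_proj M U) T))\<^sup>2
        in invertible (gram U\<^sub>\<Omega>)
         \<and> (\<gamma> \<noteq> 1 \<longrightarrow>
              (m * (1 - \<alpha>) - n2 * n3 * \<mu> * (\<beta> / (1 - \<gamma>))) / (n1 * n3) * (cos \<theta>)\<^sup>2 * residual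
              \<le> (norm (t\<^sub>\<Omega> - P\<^sub>\<Omega> *v t\<^sub>\<Omega>))\<^sup>2)
         \<and> (norm (t\<^sub>\<Omega> - P\<^sub>\<Omega> *v t\<^sub>\<Omega>))\<^sup>2
              \<le> (1 + \<alpha>) * (m / (n1 * n3)) * (cos \<theta>)\<^sup>2 * residual"
      using inv
      unfolding Let_def W_def[symmetric] A_def[symmetric] t R_def[symmetric] of_nat_mult
        D_def[symmetric]
        mult.assoc[of _ "(cos \<theta>)\<^sup>2"] residual p by blast
  qed
qed

end
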